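(* Consider an autonomous system $\dot{\mathbf{x}}=\mathbf{h}(\mathbf{x})$ on $\mathbb{R}^n$ which is semi-contracting in a bounded metric $\mathbf{M}(\mathbf{x})$, i.e. there are constants $\beta_0,\beta_1$ with $$\mathbf{0}\prec\beta_0^2\,\mathbf{I}\preceq\mathbf{M}(\mathbf{x})\preceq\beta_1^2\,\mathbf{I}\qquad\text{for all }\mathbf{x}.$$ If an equilibrium of the system is locally asymptotically stable, then it is globally asymptotically stable. In particular, if the linearization of the system at some equilibrium point is strictly stable, then all system trajectories tend to this equilibrium.
   Context: All functions are assumed sufficiently smooth that derivatives of the necessary order exist and are continuous. A metric is a function $\mathbf{M}:\mathbb{R}^n\to\mathbb{R}^{n\times n}$ whose values are symmetric positive definite matrices. A system $\dot{\mathbf{x}}=\mathbf{h}(\mathbf{x},t)$ is semi-contracting with respect to $\mathbf{M}$ if for all $t\in\mathbb{R}$ and all $\mathbf{x}\in\mathbb{R}^n$, $\dot{\mathbf{M}}+\mathbf{A}^\top\mathbf{M}+\mathbf{M}\mathbf{A}\preceq\mathbf{0}$, where $\mathbf{A}=\frac{\partial\mathbf{h}}{\partial\mathbf{x}}$ and $\dot{\mathbf{M}}=\sum_i\frac{\partial\mathbf{M}}{\partial x_i}h_i$. The linearization at an equilibrium is strictly stable if all eigenvalues of the Jacobian of the dynamics there have strictly negative real part. *)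

theory Defs
  imports "HOL-Analysis.Analysis"
begin

(* Continuity of all directional derivatives is, in finite dimension, the same as
   continuity of the derivative in operator norm. *)
definition C1 :: "(real^'n \<Rightarrow> 'b::real_normed_vector) \<Rightarrow> bool" where
  "C1 f \<longleftrightarrow> (\<forall>x. f differentiable (at x)) \<and>
     (\<forall>v. continuous_on UNIV (\<lambda>x. frechet_derivative f (at x) v))"

definition pos_semidef :: "real^'n^'n \<Rightarrow> bool" where
  "pos_semidef A \<longleftrightarrow> transpose A = A \<and> (\<forall>v. 0 \<le> v \<bullet> (A *v v))"

definition pos_def :: "real^'n^'n \<Rightarrow> bool" where
  "pos_def A \<longleftrightarrow> transpose A = A \<and> (\<forall>v. v \<noteq> 0 \<longrightarrow> 0 < v \<bullet> (A *v v))"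

definition loewner_le :: "real^'n^'n \<Rightarrow> real^'n^'n \<Rightarrow> bool"  (infix "\<preceq>" 50) where
  "A \<preceq> B \<longleftrightarrow> pos_semidef (B - A)"

definition loewner_less :: "real^'n^'n \<Rightarrow> real^'n^'n \<Rightarrow> bool"  (infix "\<prec>" 50) where
  "A \<prec> B \<longleftrightarrow> pos_def (B - A)"

definition is_metric :: "(real^'n \<Rightarrow> real^'n^'n) \<Rightarrow> bool" where
  "is_metric M \<longleftrightarrow> C1 M \<and> (\<forall>x. pos_def (M x))"

(* frechet_derivative M (at x) (axis i 1) is the partial derivative of M in the
   i-th coordinate direction. *)
definition metric_dot ::
    "(real^'n \<Rightarrow> real^'n^'n) \<Rightarrow> (real^'n \<Rightarrow> real \<Rightarrow> real^'n) \<Rightarrow> real^'n \<Rightarrow> real \<Rightarrow> real^'n^'n" where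
  "metric_dot M h x t = (\<Sum>i\<in>UNIV. (h x t $ i) *\<^sub>R frechet_derivative M (at x) (axis i 1))"

definition semi_contracting ::
    "(real^'n \<Rightarrow> real \<Rightarrow> real^'n) \<Rightarrow> (real^'n \<Rightarrow> real^'n^'n) \<Rightarrow> bool" where
  "semi_contracting h M \<longleftrightarrow>
     (\<forall>t x. let A = jacobian (\<lambda>y. h y t) (at x) in
        metric_dot M h x t + transpose A ** M x + M x ** A \<preceq> 0)"

definition equilibrium :: "(real^'n \<Rightarrow> real^'n) \<Rightarrow> real^'n \<Rightarrow> bool" where
  "equilibrium h p \<longleftrightarrow> h p = 0"

definition trajectory :: "(real^'n \<Rightarrow> real^'n) \<Rightarrow> real^'n \<Rightarrow> (real \<Rightarrow> real^'n) \<Rightarrow> bool" where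
  "trajectory h x0 x \<longleftrightarrow> x 0 = x0 \<and>
     (\<forall>t\<ge>0. (x has_vector_derivative h (x t)) (at t within {0..}))"

(* Forward completeness is not assumed of the system. Hence each stability notion asks
   explicitly that trajectories exist for all t \<ge> 0, so that none of them can hold
   because of finite-time blow-up. *)
definition lyapunov_stable :: "(real^'n \<Rightarrow> real^'n) \<Rightarrow> real^'n \<Rightarrow> bool" where
  "lyapunov_stable h p \<longleftrightarrow>
     (\<forall>\<epsilon>>0. \<exists>\<delta>>0. \<forall>x0. dist x0 p < \<delta> \<longrightarrow>
        (\<exists>x. trajectory h x0 x) \<and>
        (\<forall>x. trajectory h x0 x \<longrightarrow> (\<forall>t\<ge>0. dist (x t) p < \<epsilon>)))"

definition attracted_to :: "(real^'n \<Rightarrow> real^'n) \<Rightarrow> real^'n \<Rightarrow> real^'n \<Rightarrow> bool" where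
  "attracted_to h x0 p \<longleftrightarrow>
     (\<exists>x. trajectory h x0 x) \<and>
     (\<forall>x. trajectory h x0 x \<longrightarrow> (x \<longlongrightarrow> p) at_top)"

definition locally_asymptotically_stable :: "(real^'n \<Rightarrow> real^'n) \<Rightarrow> real^'n \<Rightarrow> bool" where
  "locally_asymptotically_stable h p \<longleftrightarrow>
     lyapunov_stable h p \<and> (\<exists>\<delta>>0. \<forall>x0. dist x0 p < \<delta> \<longrightarrow> attracted_to h x0 p)"

definition globally_asymptotically_stable :: "(real^'n \<Rightarrow> real^'n) \<Rightarrow> real^'n \<Rightarrow> bool" where
  "globally_asymptotically_stable h p \<longleftrightarrow>
     lyapunov_stable h p \<and> (\<forall>x0. attracted_to h x0 p)"

definition eigenvalues :: "real^'n^'n \<Rightarrow> complex set" where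
  "eigenvalues A =
     {c. \<exists>v::complex^'n. v \<noteq> 0 \<and> map_matrix complex_of_real A *v v = c *s v}"

definition strictly_stable_linearization :: "(real^'n \<Rightarrow> real^'n) \<Rightarrow> real^'n \<Rightarrow> bool" where
  "strictly_stable_linearization h p \<longleftrightarrow>
     (\<forall>c \<in> eigenvalues (jacobian h (at p)). Re c < 0)"

end

theory Submission
  imports Defs
begin

text \<open>Semi-contraction makes the flow expand Euclidean distances by at most the factor
  \<open>\<kappa> = \<beta>1 / \<beta>0\<close>. This is shown without differentiating the flow in the initial value: two
  trajectories that are close enough satisfy the infinitesimal estimate up to an arbitrarily small
  exponential rate, and a segment of initial values is cut into many short pieces. Hence a point
  of the basin of attraction comes with a ball of a radius that does not depend on the point, so
  the basin is open and closed, and equals the whole space. The same bound provides global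
  existence of the trajectories.

  At an equilibrium with strictly stable linearization \<open>A\<close>, put \<open>Q = - (A\<^sup>T M + M A) \<succeq> 0\<close>. On the
  largest \<open>A\<close>-invariant subspace of the kernel of \<open>Q\<close> the matrix \<open>A\<close> is skew for the inner product
  \<open>M\<close>, so a nonzero subspace would carry an imaginary eigenvalue. Thus \<open>(Q, A)\<close> is observable, and
  adding small cross terms to \<open>M\<close> gives a strict quadratic Lyapunov function.\<close>

section \<open>Differential equations with a Lipschitz right-hand side\<close>

text \<open>Integrating \<open>C * exp (r * s)\<close> gains the factor \<open>1 / r\<close>. This
  makes the Picard operator a contraction in an exponentially weighted norm.\<close>

lemma integral_norm_exp_bound:
  fixes f :: "real \<Rightarrow> 'a::banach"
  assumes "continuous_on {0..t} f" "0 \<le> t" "0 < r" "0 \<le> C"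
    and le: "\<And>s. s \<in> {0..t} \<Longrightarrow> norm (f s) \<le> C * exp (r * s)"
  shows "exp (- r * t) * norm (integral {0..t} f) \<le> C / r"
proof -
  have "((\<lambda>s. C * exp (r * s)) has_integral C * exp (r * t) / r - C * exp (r * 0) / r) {0..t}"
    using assms(2,3)
    by (intro fundamental_theorem_of_calculus)
       (auto intro!: derivative_eq_intros simp flip: has_real_derivative_iff_has_vector_derivative)
  then have "norm (integral {0..t} f) \<le> C * exp (r * t) / r - C * exp (r * 0) / r"
    using integral_norm_bound_integral[of f "{0..t}" "\<lambda>s. C * exp (r * s)"] le
      integrable_continuous_real[OF assms(1)] by (metis has_integral_iff)
  also have "\<dots> \<le> C * exp (r * t) / r"
    using assms by simp
  finally have "exp (- r * t) * norm (integral {0..t} f) \<le> exp (- r * t) * (C * exp (r * t) / r)"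
    by (intro mult_left_mono) auto
  also have "\<dots> = C / r * exp (- r * t + r * t)"
    unfolding exp_add by simp
  finally show ?thesis by simp
qed

lemma mult_exp_neg_le:
  fixes t :: real
  assumes "0 < r" "0 \<le> t"
  shows "t * exp (- r * t) \<le> 1 / r"
proof -
  have "r * t \<le> exp (r * t)"
    using exp_ge_add_one_self[of "r * t"] by linarith
  then show ?thesis using assms by (simp add: exp_minus field_simps)
qed

text \<open>Banach's fixed point theorem is applied on bounded continuous functions, with unknown
  \<open>exp (- r * t) *\<^sub>R (x t - x0)\<close>. The weight gives contraction on the whole
  half-line at once, so no local solutions have to be glued.\<close>

lemma lipschitz_ode_solution_exists:
  fixes g :: "'a::euclidean_space \<Rightarrow> 'a"
  assumes lip: "L-lipschitz_on UNIV g"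
  shows "\<exists>x. x 0 = x0 \<and> (\<forall>t\<ge>0. (x has_vector_derivative g (x t)) (at t within {0..}))"
proof -
  \<comment> \<open>Any weight above \<open>L\<close> gives a contraction factor
    \<open>L / r < 1\<close>; adding 1 also keeps \<open>r\<close> positive when
    \<open>L = 0\<close>.\<close>
  define r where "r = L + 1"
  have L: "0 \<le> L" using lip by (rule lipschitz_on_nonneg)
  then have r: "0 < r" by (simp add: r_def)
  have cg: "continuous_on S g" for S
    using lip lipschitz_on_continuous_on lipschitz_on_subset by blast
  define G where "G u s = g (x0 + exp (r * s) *\<^sub>R apply_bcontfun u s)" for u s
  have cG: "continuous_on S (G u)" for S u
    unfolding G_def by (intro continuous_on_compose2[OF cg[of UNIV]] continuous_intros) auto
  \<comment> \<open>The unknown lives on the whole real line; \<open>max 0 t\<close> extends the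
    operator constantly to negative times.\<close>
  define F where "F u t = exp (- r * max 0 t) *\<^sub>R integral {0..max 0 t} (G u)" for u t
  have dG: "norm (G u s - G v s) \<le> L * dist u v * exp (r * s)" for u v s
  proof -
    have "norm (G u s - G v s) \<le> L * norm (exp (r * s) *\<^sub>R (u s - v s))"
      using lipschitz_onD[OF lip, of "x0 + exp (r * s) *\<^sub>R u s" "x0 + exp (r * s) *\<^sub>R v s"]
      by (simp add: G_def dist_norm algebra_simps)
    also have "\<dots> = L * (exp (r * s) * dist (u s) (v s))"
      by (simp add: dist_norm)
    also have "\<dots> \<le> L * (exp (r * s) * dist u v)"
      by (intro mult_left_mono dist_bounded L) auto
    finally show ?thesis by (simp add: algebra_simps)
  qed
  have intG: "G u integrable_on {0..t}" for u t
    by (intro integrable_continuous_real cG)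
  have dF: "dist (F u t) (F v t) \<le> L / r * dist u v" for u v t
  proof -
    have "norm (F u t - F v t) = exp (- r * max 0 t) * norm (integral {0..max 0 t} (\<lambda>s. G u s - G v s))"
      by (simp add: F_def intG integral_diff flip: scaleR_diff_right)
    also have "\<dots> \<le> L * dist u v / r"
      using dG L r by (intro integral_norm_exp_bound) (auto intro!: continuous_on_diff cG)
    finally show ?thesis by (simp add: dist_norm)
  qed
  \<comment> \<open>One bounded image suffices: together with \<open>dF\<close> it bounds
    \<open>F u\<close> for every \<open>u\<close>.\<close>
  have F0: "norm (F (0) t) \<le> norm (g x0) / r" for t
  proof -
    have "G (0) = (\<lambda>s. g x0)"
      by (simp add: fun_eq_iff G_def zero_bcontfun.rep_eq)
    then show ?thesis
      using mult_right_mono[OF mult_exp_neg_le[OF r, of "max 0 t"], of "norm (g x0)"]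
      by (simp add: F_def mult_ac)
  qed
  have cF: "continuous_on UNIV (F u)" for u
  proof -
    have "continuous_on {0..} (\<lambda>t. integral {0..t} (G u))"
    proof (rule continuous_on_vector_derivative)
      fix t :: real assume t: "t \<in> {0..}"
      \<comment> \<open>The window up to \<open>t + 1\<close> is a relative neighbourhood of
        \<open>t\<close> in the half-line, so the derivative transfers.\<close>
      have "((\<lambda>t. integral {0..t} (G u)) has_vector_derivative G u t) (at t within {0..t+1})"
        using t by (intro integral_has_vector_derivative cG) auto
      then show "((\<lambda>t. integral {0..t} (G u)) has_vector_derivative G u t) (at t within {0..})"
        using t by (subst at_within_nhd[of t "{..<t+1}" "{0..}" "{0..t+1}"]) auto
    qed
    then have "continuous_on UNIV (\<lambda>t. integral {0..max 0 t} (G u))"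
    proof (rule continuous_on_compose2[of _ _ UNIV "max 0"])
      show "continuous_on UNIV (max (0::real))"
        using continuous_on_max[OF continuous_on_const continuous_on_id, of UNIV "0::real"] by simp
    qed auto
    then show ?thesis unfolding F_def by (intro continuous_intros)
  qed
  have bF: "bounded (range (F u))" for u
    unfolding bounded_any_center[where a = "0"]
  proof (intro exI ballI, clarify)
    fix t
    show "dist 0 (F u t) \<le> norm (g x0) / r + L / r * dist u (0)"
      using dF[of u t "0"] F0[of t] norm_triangle_sub[of "F u t" "F (0) t"]
      by (simp add: dist_norm)
  qed
  define T where "T u = Bcontfun (F u)" for u
  have T: "apply_bcontfun (T u) = F u" for u
    unfolding T_def by (rule Bcontfun_inverse) (use cF bF in \<open>auto simp: bcontfun_def\<close>)
  have "\<exists>!u. T u = u"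
  proof (rule banach_fix_type)
    show "0 \<le> L / r" "L / r < 1" using L by (auto simp: r_def)
    show "\<forall>u v. dist (T u) (T v) \<le> L / r * dist u v"
      by (intro allI dist_bound) (simp only: T dF)
  qed
  then obtain u where u: "T u = u" by blast
  define x where "x t = x0 + integral {0..t} (G u)" for t
  \<comment> \<open>Multiplying the fixed point equation by \<open>exp (r * t)\<close> turns it into
    the integral equation for \<open>x\<close>.\<close>
  have xu: "G u t = g (x t)" if "0 \<le> t" for t
  proof -
    have "apply_bcontfun u t = F u t" using T[of u] u by simp
    then have "exp (r * t) *\<^sub>R apply_bcontfun u t = (exp (r * t) * exp (- r * t)) *\<^sub>R integral {0..t} (G u)"
      using that by (simp add: F_def)
    also have "exp (r * t) * exp (- r * t) = 1"
      by (simp flip: exp_add)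
    finally have "exp (r * t) *\<^sub>R apply_bcontfun u t = integral {0..t} (G u)" by simp
    then show ?thesis unfolding x_def by (subst G_def) (simp only:)
  qed
  have "(x has_vector_derivative g (x t)) (at t within {0..})" if t: "0 \<le> t" for t
  proof -
    have "((\<lambda>t. integral {0..t} (G u)) has_vector_derivative G u t) (at t within {0..t+1})"
      using t by (intro integral_has_vector_derivative cG) auto
    then have "((\<lambda>t. integral {0..t} (G u)) has_vector_derivative G u t) (at t within {0..})"
      using t by (subst at_within_nhd[of t "{..<t+1}" "{0..}" "{0..t+1}"]) auto
    then show ?thesis
      unfolding x_def[abs_def] using xu[OF t]
      by (auto intro!: derivative_eq_intros simp: x_def)
  qed
  moreover have "x 0 = x0" by (simp add: x_def)
  ultimately show ?thesis by blast
qed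

text \<open>Gronwall's inequality: \<open>exp (- c * t) * f t\<close> is nonincreasing. The rate
  \<open>c\<close> may have either sign; a negative one later gives exponential decay.\<close>

lemma differential_inequality_exp_bound:
  fixes f :: "real \<Rightarrow> real"
  assumes T: "0 \<le> T" and cont: "continuous_on {0..T} f"
    and deriv: "\<And>t. 0 < t \<Longrightarrow> t < T \<Longrightarrow> (f has_real_derivative f' t) (at t)"
    and le: "\<And>t. 0 < t \<Longrightarrow> t < T \<Longrightarrow> f' t \<le> c * f t"
  shows "f T \<le> exp (c * T) * f 0"
proof -
  have "exp (- c * T) * f T \<le> exp (- c * 0) * f 0"
  proof (rule DERIV_nonpos_imp_decreasing_open[OF T])
    show "continuous_on {0..T} (\<lambda>t. exp (- c * t) * f t)"
      by (intro continuous_intros cont)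
    fix t assume t: "0 < t" "t < T"
    have "((\<lambda>t. exp (- c * t) * f t) has_real_derivative exp (- c * t) * (f' t - c * f t)) (at t)"
      by (rule derivative_eq_intros deriv t refl)+ (simp add: algebra_simps)
    moreover have "exp (- c * t) * (f' t - c * f t) \<le> 0"
      using le[OF t] by (intro mult_nonneg_nonpos) auto
    ultimately show "\<exists>y. ((\<lambda>t. exp (- c * t) * f t) has_real_derivative y) (at t) \<and> y \<le> 0" by blast
  qed
  then show ?thesis by (simp add: exp_minus field_simps)
qed

text \<open>Gronwall's inequality for the squared distance, which starts at 0 and by Cauchy-Schwarz
  grows at rate at most \<open>2 * L\<close>.\<close>

lemma lipschitz_ode_unique:
  fixes g :: "'a::real_inner \<Rightarrow> 'a"
  assumes lip: "L-lipschitz_on K g" and T: "0 \<le> T" and start: "x 0 = y 0"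
    and cont: "continuous_on {0..T} x" "continuous_on {0..T} y"
    and sol: "\<And>t. 0 < t \<Longrightarrow> t < T \<Longrightarrow> (x has_vector_derivative g (x t)) (at t)"
      "\<And>t. 0 < t \<Longrightarrow> t < T \<Longrightarrow> (y has_vector_derivative g (y t)) (at t)"
    and K: "\<And>t. 0 < t \<Longrightarrow> t < T \<Longrightarrow> x t \<in> K \<and> y t \<in> K"
  shows "x T = y T"
proof -
  define f where "f t = (x t - y t) \<bullet> (x t - y t)" for t
  have "f T \<le> exp (2 * L * T) * f 0"
  proof (rule differential_inequality_exp_bound[OF T])
    show "continuous_on {0..T} f" unfolding f_def by (intro continuous_intros cont)
    fix t assume t: "0 < t" "t < T"
    have "((\<lambda>t. x t - y t) has_vector_derivative g (x t) - g (y t)) (at t)"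
      by (intro derivative_intros sol t)
    from bounded_bilinear.has_vector_derivative[OF bounded_bilinear_inner this this]
    show "(f has_real_derivative 2 * ((x t - y t) \<bullet> (g (x t) - g (y t)))) (at t)"
      by (simp add: f_def[abs_def] has_real_derivative_iff_has_vector_derivative inner_commute)
    have "(x t - y t) \<bullet> (g (x t) - g (y t)) \<le> norm (x t - y t) * norm (g (x t) - g (y t))"
      by (rule norm_cauchy_schwarz)
    also have "\<dots> \<le> norm (x t - y t) * (L * norm (x t - y t))"
      using lipschitz_onD[OF lip, of "x t" "y t"] K[OF t] by (intro mult_left_mono) (auto simp: dist_norm)
    finally show "2 * ((x t - y t) \<bullet> (g (x t) - g (y t))) \<le> 2 * L * f t"
      by (simp add: f_def power2_norm_eq_inner[symmetric] power2_eq_square mult_ac)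
  qed
  then have "(x T - y T) \<bullet> (x T - y T) \<le> 0" by (simp add: f_def start)
  then show ?thesis by (metis inner_eq_zero_iff inner_ge_zero order_antisym right_minus_eq)
qed

section \<open>Continuously differentiable maps\<close>

lemma C1_has_derivative: "C1 f \<Longrightarrow> (f has_derivative frechet_derivative f (at x)) (at x)"
  by (simp add: C1_def frechet_derivative_works)

lemma C1_bounded_linear: "C1 f \<Longrightarrow> bounded_linear (frechet_derivative f (at x))"
  using C1_has_derivative has_derivative_bounded_linear by blast

lemma C1_continuous_on_derivative:
  "C1 f \<Longrightarrow> continuous_on S (\<lambda>x. frechet_derivative f (at x) v)"
  by (auto simp: C1_def intro: continuous_on_subset)

text \<open>The operator norm is at most the sum of the norms on a basis, which is continuous in
  \<open>x\<close> and thus bounded on \<open>K\<close>; convexity then allows the mean value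
  inequality.\<close>

lemma C1_lipschitz_on_compact:
  fixes f :: "real^'n \<Rightarrow> 'b::real_normed_vector"
  assumes f: "C1 f" and K: "compact K" "convex K"
  shows "\<exists>L. L-lipschitz_on K f"
proof -
  define D where "D x = (\<Sum>b\<in>Basis. norm (frechet_derivative f (at x) b))" for x
  have "continuous_on K D"
    unfolding D_def by (intro continuous_intros C1_continuous_on_derivative[OF f])
  then have "bounded (D ` K)"
    by (intro compact_imp_bounded compact_continuous_image K)
  then obtain B where B: "0 < B" "\<And>x. x \<in> K \<Longrightarrow> norm (D x) \<le> B"
    by (auto simp: bounded_pos)
  have "norm (f x - f y) \<le> B * norm (x - y)" if "x \<in> K" "y \<in> K" for x y
  proof (rule differentiable_bound[OF K(2) _ _ that])
    fix x assume x: "x \<in> K"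
    show "(f has_derivative frechet_derivative f (at x)) (at x within K)"
      using C1_has_derivative[OF f] by (rule has_derivative_at_withinI)
    show "onorm (frechet_derivative f (at x)) \<le> B"
      using onorm_componentwise[OF C1_bounded_linear[OF f, of x]] B(2)[OF x] by (simp add: D_def)
  qed
  then show ?thesis
    using B(1) by (auto simp: lipschitz_on_def dist_norm intro!: exI[of _ B])
qed

text \<open>Uniform continuity of the derivative on the compact set makes \<open>d\<close>
  independent of the base point.\<close>

lemma C1_uniform_linearization:
  fixes f :: "real^'n \<Rightarrow> 'b::real_normed_vector"
  assumes f: "C1 f" and K: "compact K" "convex K" and e: "0 < e"
  shows "\<exists>d>0. \<forall>x\<in>K. \<forall>y\<in>K. norm (y - x) < d \<longrightarrow>
    norm (f y - f x - frechet_derivative f (at x) (y - x)) \<le> e * norm (y - x)"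
proof -
  \<comment> \<open>\<open>D (x, z)\<close> dominates the operator norm of the difference of the
    derivatives at \<open>x\<close> and \<open>z\<close>, and it vanishes on the diagonal.\<close>
  define D where "D z = (\<Sum>b\<in>Basis. norm (frechet_derivative f (at (snd z)) b - frechet_derivative f (at (fst z)) b))" for z
  have "continuous_on (K \<times> K) D"
    unfolding D_def
    by (intro continuous_intros continuous_on_compose2[OF C1_continuous_on_derivative[OF f, of UNIV]]) auto
  then have "uniformly_continuous_on (K \<times> K) D"
    by (intro compact_uniformly_continuous compact_Times K)
  then obtain d where d: "0 < d"
    "\<And>z z'. z \<in> K \<times> K \<Longrightarrow> z' \<in> K \<times> K \<Longrightarrow> dist z' z < d \<Longrightarrow> dist (D z') (D z) < e"
    using e unfolding uniformly_continuous_on_def by metis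
  have "norm (f y - f x - frechet_derivative f (at x) (y - x)) \<le> norm (y - x) * e"
    if x: "x \<in> K" and y: "y \<in> K" and xy: "norm (y - x) < d" for x y
  proof (rule differentiable_bound_linearization)
    have "convex (K \<inter> ball x d)" by (intro convex_Int K convex_ball)
    moreover have "x \<in> K \<inter> ball x d" "y \<in> K \<inter> ball x d"
      using x y xy d(1) by (auto simp: dist_norm norm_minus_commute)
    ultimately show "x + t *\<^sub>R (y - x) \<in> K \<inter> ball x d" if "t \<in> {0..1}" for t
      using that convexD_alt[of "K \<inter> ball x d" x y t] by (simp add: algebra_simps)
    show "(f has_derivative frechet_derivative f (at z)) (at z within K \<inter> ball x d)" for z
      using C1_has_derivative[OF f] by (rule has_derivative_at_withinI)
    show "x \<in> K \<inter> ball x d" using x d(1) by simp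
    fix z assume z: "z \<in> K \<inter> ball x d"
    have "dist (D (x, z)) (D (x, x)) < e"
      using x z by (intro d(2)) (auto simp: dist_Pair_Pair dist_commute)
    then have "D (x, z) < e" by (simp add: D_def dist_norm)
    moreover have "bounded_linear (\<lambda>v. frechet_derivative f (at z) v - frechet_derivative f (at x) v)"
      by (intro bounded_linear_sub C1_bounded_linear f)
    note onorm_componentwise[OF this]
    ultimately show "onorm (frechet_derivative f (at z) - frechet_derivative f (at x)) \<le> e"
      by (simp add: D_def fun_diff_def)
  qed
  then show ?thesis using d(1) by (auto simp: mult.commute)
qed

section \<open>Quadratic forms\<close>

lemma bounded_bilinear_matrix_vector_mult:
  "bounded_bilinear (\<lambda>(A::real^'n^'m) v. A *v v)"
proof -
  have "bilinear (\<lambda>(A::real^'n^'m) v. A *v v)"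
    unfolding bilinear_def linear_iff
    by (simp add: matrix_vector_right_distrib matrix_vector_mult_add_rdistrib
        matrix_vector_mult_scaleR scaleR_matrix_vector_assoc)
  then show ?thesis by (simp add: bilinear_conv_bounded_bilinear)
qed

text \<open>The first-order condition for a minimum at \<open>t = 0\<close>, where the polynomial
  vanishes; it yields variational equations without differentiation.\<close>

lemma linear_quadratic_nonneg_imp_zero:
  fixes b c :: real
  assumes "\<And>t. 0 \<le> t * b + t\<^sup>2 * c"
  shows "b = 0"
proof (rule ccontr)
  assume b: "b \<noteq> 0"
  \<comment> \<open>With \<open>c < d\<close> the value at \<open>t = - b / d\<close> is negative,
    whatever the sign of \<open>c\<close>.\<close>
  define d where "d = \<bar>c\<bar> + 1"
  have d: "0 < d" "c < d" by (auto simp: d_def)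
  have "0 \<le> (- b / d) * b + (- b / d)\<^sup>2 * c" by (rule assms)
  also have "\<dots> = b\<^sup>2 / d * (c / d - 1)"
    using d by (simp add: field_simps power2_eq_square)
  also have "\<dots> < 0"
    using b d by (intro mult_pos_neg) auto
  finally show False by simp
qed

lemma symmetric_form_commute:
  fixes Q :: "real^'n^'n"
  assumes "transpose Q = Q"
  shows "a \<bullet> (Q *v b) = b \<bullet> (Q *v a)"
proof -
  have "a \<bullet> (Q *v b) = (transpose Q *v a) \<bullet> b" by (simp add: dot_lmul_matrix)
  also have "\<dots> = b \<bullet> (Q *v a)" unfolding assms by (rule inner_commute)
  finally show ?thesis .
qed

lemma symmetric_form_add:
  fixes Q :: "real^'n^'n"
  assumes "transpose Q = Q"
  shows "(v + t *\<^sub>R w) \<bullet> (Q *v (v + t *\<^sub>R w)) =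
    v \<bullet> (Q *v v) + 2 * t * (w \<bullet> (Q *v v)) + t\<^sup>2 * (w \<bullet> (Q *v w))"
  using symmetric_form_commute[OF assms, of v w]
  by (simp add: algebra_simps inner_add_left inner_add_right matrix_vector_mult_scaleR power2_eq_square)

text \<open>Young's inequality, from expanding the form at \<open>b + \<tau> *\<^sub>R a\<close>.
  The parameter \<tau> decides which of the two squares gets the small weight.\<close>

lemma pos_semidef_form_ge:
  assumes "pos_semidef Q" "0 < \<tau>"
  shows "- (\<tau> / 2) * (a \<bullet> (Q *v a)) - 1 / (2 * \<tau>) * (b \<bullet> (Q *v b)) \<le> a \<bullet> (Q *v b)"
proof -
  have "0 \<le> (b + \<tau> *\<^sub>R a) \<bullet> (Q *v (b + \<tau> *\<^sub>R a))"
    using assms(1) by (simp add: pos_semidef_def)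
  then have "0 \<le> (b \<bullet> (Q *v b) + 2 * \<tau> * (a \<bullet> (Q *v b)) + \<tau>\<^sup>2 * (a \<bullet> (Q *v a))) / (2 * \<tau>)"
    using assms by (subst (asm) symmetric_form_add) (auto simp: pos_semidef_def)
  also have "\<dots> = 1 / (2 * \<tau>) * (b \<bullet> (Q *v b)) + a \<bullet> (Q *v b) + (\<tau> / 2) * (a \<bullet> (Q *v a))"
    using assms(2) by (simp add: field_simps power2_eq_square)
  finally show ?thesis by simp
qed

text \<open>A zero of a nonnegative form is a minimum, so the first variation vanishes; the
  direction \<open>Q *v v\<close> turns it into a squared norm.\<close>

lemma pos_semidef_null_vector:
  assumes Q: "pos_semidef Q" and v: "v \<bullet> (Q *v v) = 0"
  shows "Q *v v = 0"
proof -
  have "2 * ((Q *v v) \<bullet> (Q *v v)) = 0"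
  proof (rule linear_quadratic_nonneg_imp_zero)
    fix t
    have "0 \<le> (v + t *\<^sub>R (Q *v v)) \<bullet> (Q *v (v + t *\<^sub>R (Q *v v)))"
      using Q by (simp add: pos_semidef_def)
    then show "0 \<le> t * (2 * ((Q *v v) \<bullet> (Q *v v))) + t\<^sup>2 * ((Q *v v) \<bullet> (Q *v (Q *v v)))"
      using Q v by (subst (asm) symmetric_form_add) (auto simp: pos_semidef_def)
  qed
  then show ?thesis by simp
qed

lemma continuous_on_matrix_vector_mult [continuous_intros]:
  fixes A :: "real^'n^'m"
  assumes "continuous_on S f"
  shows "continuous_on S (\<lambda>x. A *v f x)"
  by (rule bounded_linear.continuous_on[OF matrix_vector_mul_bounded_linear assms])

text \<open>Compactness of the unit sphere gives a positive minimum, which homogeneity spreads to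
  all vectors.\<close>

lemma homogeneous_quadratic_ge:
  fixes f :: "'a::euclidean_space \<Rightarrow> real"
  assumes cont: "continuous_on UNIV f"
    and hom: "\<And>r v. f (r *\<^sub>R v) = r\<^sup>2 * f v"
    and pos: "\<And>v. v \<noteq> 0 \<Longrightarrow> 0 < f v"
  obtains c where "0 < c" "\<And>v. c * (norm v)\<^sup>2 \<le> f v"
proof -
  have "sphere (0::'a) 1 \<noteq> {}" by simp
  then obtain w where w: "w \<in> sphere 0 1" "\<And>v. v \<in> sphere 0 1 \<Longrightarrow> f w \<le> f v"
    using continuous_attains_inf[OF compact_sphere _ continuous_on_subset[OF cont subset_UNIV]] by metis
  show thesis
  proof
    show "0 < f w" using w(1) by (intro pos) auto
    fix v
    show "f w * (norm v)\<^sup>2 \<le> f v"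
    proof (cases "v = 0")
      case True then show ?thesis using hom[of 0 0] by simp
    next
      case False
      then have "f v = (norm v)\<^sup>2 * f (v /\<^sub>R norm v)"
        using hom[of "norm v" "v /\<^sub>R norm v"] by simp
      then show ?thesis using w(2)[of "v /\<^sub>R norm v"] False by (simp add: mult.commute mult_left_mono)
    qed
  qed
qed

text \<open>For \<open>a = b\<close> the right-hand side is the derivative of the form of
  \<open>M\<close> along \<open>v' = A v\<close>, with the transpose removed.\<close>

lemma lyapunov_bilinear_form:
  fixes A M :: "real^'n^'n"
  shows "a \<bullet> ((transpose A ** M + M ** A) *v b) = (A *v a) \<bullet> (M *v b) + a \<bullet> (M *v (A *v b))"
proof -
  have "a \<bullet> (transpose A *v c) = (A *v a) \<bullet> c" for c
    by (metis dot_lmul_matrix inner_commute transpose_matrix_vector)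
  then show ?thesis
    by (simp add: matrix_vector_mult_add_rdistrib inner_add_right del: transpose_matrix_vector
        flip: matrix_vector_mul_assoc)
qed

lemma linear_matrix_funpow: "linear (((*v) (A::real^'n^'n)) ^^ k)"
proof (induction k)
  case 0 show ?case by (simp add: linear_id[unfolded id_def] id_def)
next
  case (Suc k)
  show ?case using linear_compose[OF Suc matrix_vector_mul_linear[of A]] by (simp add: comp_def)
qed

lemma continuous_on_matrix_funpow [continuous_intros]:
  fixes A :: "real^'n^'n"
  assumes "continuous_on S f"
  shows "continuous_on S (\<lambda>x. ((*v) A ^^ k) (f x))"
  by (rule bounded_linear.continuous_on[OF linear_matrix_funpow[unfolded linear_conv_bounded_linear] assms])

lemma pos_def_form_ge:
  fixes M :: "real^'n^'n"
  assumes "pos_def M"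
  obtains c where "0 < c" "\<And>v. c * (norm v)\<^sup>2 \<le> v \<bullet> (M *v v)"
proof -
  let ?f = "\<lambda>v. v \<bullet> (M *v v)"
  have cont: "continuous_on UNIV ?f" by (intro continuous_intros)
  have hom: "?f (r *\<^sub>R v) = r\<^sup>2 * ?f v" for r v
    by (simp add: matrix_vector_mult_scaleR power2_eq_square)
  have pos: "0 < ?f v" if "v \<noteq> 0" for v
    using assms that by (simp add: pos_def_def)
  show thesis
    using homogeneous_quadratic_ge[of ?f, OF cont hom pos] that by metis
qed

lemma matrix_vector_mult_minus_left:
  fixes A :: "real^'n^'m"
  shows "(- A) *v v = - (A *v v)"
  using matrix_vector_mult_diff_rdistrib[of 0 A v] by simp

section \<open>Lyapunov forms of strictly stable matrices\<close>

lemma matrix_vector_mult_complexify: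
  "map_matrix complex_of_real A *v (\<chi> i. Complex (x $ i) (y $ i)) =
     (\<chi> i. Complex ((A *v x) $ i) ((A *v y) $ i))"
  by (simp add: vec_eq_iff matrix_vector_mult_def map_matrix_def complex_eq_iff)

text \<open>If \<open>\<omega> \<noteq> 0\<close> then \<open>A v + i \<omega> v\<close> is an
  eigenvector for \<open>i \<omega>\<close>; if \<open>\<omega> = 0\<close> then \<open>v\<close> or
  \<open>A *v v\<close> is a nonzero kernel vector.\<close>

lemma square_eigenvector_imp_imaginary_eigenvalue:
  fixes A :: "real^'n^'n"
  assumes A: "A *v (A *v v) = - (\<omega>\<^sup>2) *\<^sub>R v" and v: "v \<noteq> 0"
  shows "\<exists>c \<in> eigenvalues A. Re c = 0"
proof -
  have ker: "0 \<in> eigenvalues A" if Aw: "A *v w = 0" and w: "w \<noteq> 0" for w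
  proof -
    let ?z = "\<chi> i. Complex (w $ i) ((0::real^'n) $ i)"
    obtain i where "w $ i \<noteq> 0" using w by (auto simp: vec_eq_iff)
    then have "?z $ i \<noteq> 0" by (simp add: complex_eq_iff)
    then have "?z \<noteq> 0" by (metis zero_index)
    moreover have "map_matrix complex_of_real A *v ?z = 0 *s ?z"
      unfolding matrix_vector_mult_complexify Aw by (simp add: vec_eq_iff complex_eq_iff)
    ultimately show ?thesis unfolding eigenvalues_def by blast
  qed
  show ?thesis
  proof (cases "\<omega> = 0")
    case True
    then have "0 \<in> eigenvalues A"
      using ker[of v] ker[of "A *v v"] A v by (cases "A *v v = 0") auto
    then show ?thesis by force
  next
    case False
    define w :: "complex^'n" where "w = (\<chi> i. Complex ((A *v v) $ i) ((\<omega> *\<^sub>R v) $ i))"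
    obtain i where "v $ i \<noteq> 0" using v by (auto simp: vec_eq_iff)
    then have "w $ i \<noteq> 0" using False by (simp add: w_def complex_eq_iff)
    then have "w \<noteq> 0" by (metis zero_index)
    moreover have "map_matrix complex_of_real A *v w = (\<i> * \<omega>) *s w"
      unfolding w_def matrix_vector_mult_complexify
      by (simp add: vec_eq_iff complex_eq_iff A matrix_vector_mult_scaleR power2_eq_square)
    ultimately have "\<i> * \<omega> \<in> eigenvalues A" unfolding eigenvalues_def by blast
    then show ?thesis by force
  qed
qed

text \<open>The contradiction is an imaginary eigenvalue, obtained from a maximizer of the Rayleigh
  quotient of \<open>- A\<^sup>2\<close> on the unobservable subspace.\<close>

lemma strictly_stable_imp_observable:
  fixes A M :: "real^'n^'n"
  assumes M: "pos_def M" and Q: "Q = - (transpose A ** M + M ** A)"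
    and stable: "\<And>c. c \<in> eigenvalues A \<Longrightarrow> Re c < 0"
    and unobservable: "\<And>k. Q *v (((*v) A ^^ k) u) = 0"
  shows "u = 0"
proof (rule ccontr)
  assume u: "u \<noteq> 0"
  \<comment> \<open>Requiring the condition for all powers at once makes \<open>E\<close> invariant
    under \<open>A\<close>.\<close>
  define E where "E = {v. \<forall>k. Q *v (((*v) A ^^ k) v) = 0}"
  have uE: "u \<in> E" using unobservable by (simp add: E_def)
  have Esub: "subspace E"
    unfolding subspace_def E_def
    by (simp add: linear_add[OF linear_matrix_funpow] linear_cmul[OF linear_matrix_funpow]
        linear_0[OF linear_matrix_funpow] matrix_vector_right_distrib matrix_vector_mult_scaleR)
  have EA: "A *v v \<in> E" if "v \<in> E" for v
  proof -
    have "((*v) A ^^ k) (A *v v) = ((*v) A ^^ Suc k) v" for k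
      by (simp add: funpow_swap1)
    then show ?thesis using that unfolding E_def by (simp del: funpow.simps)
  qed
  have sym: "a \<bullet> (M *v b) = b \<bullet> (M *v a)" for a b
    using M by (intro symmetric_form_commute) (simp add: pos_def_def)
  \<comment> \<open>Vectors of \<open>E\<close> are annihilated by \<open>Q\<close>, so the two
    product rule terms cancel.\<close>
  have skew: "(A *v a) \<bullet> (M *v b) = - (a \<bullet> (M *v (A *v b)))" if "b \<in> E" for a b
  proof -
    have "Q *v b = 0" using that by (auto simp: E_def dest: spec[of _ 0])
    then have "(- Q) *v b = 0" by (simp add: matrix_vector_mult_minus_left)
    then show ?thesis using lyapunov_bilinear_form[of a A M b] by (simp add: Q add.commute)
  qed
  obtain m where m: "0 < m" "\<And>v. m * (norm v)\<^sup>2 \<le> v \<bullet> (M *v v)"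
    using pos_def_form_ge[OF M] by blast
  \<comment> \<open>The unit sphere of \<open>E\<close> for the inner product \<open>M\<close>,
    bounded because the form of \<open>M\<close> dominates a multiple of the squared norm.\<close>
  define S where "S = {v \<in> E. v \<bullet> (M *v v) = 1}"
  have "closed E"
    using Esub by (rule closed_subspace)
  moreover have "closed {v. v \<bullet> (M *v v) = 1}"
    by (intro closed_Collect_eq continuous_intros)
  ultimately have "closed S"
    unfolding S_def by (simp add: Collect_conj_eq closed_Int)
  moreover have "bounded S"
    unfolding bounded_iff
  proof (intro exI ballI)
    fix v assume "v \<in> S"
    then have "(norm v)\<^sup>2 \<le> 1 / m" using m(1) m(2)[of v] by (simp add: S_def field_simps)
    then show "norm v \<le> sqrt (1 / m)" by (rule real_le_rsqrt)
  qed
  ultimately have "compact S" by (simp add: compact_eq_bounded_closed)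
  define N where "N = u \<bullet> (M *v u)"
  have N: "0 < N" using M u by (simp add: N_def pos_def_def)
  have nS: "(1 / sqrt (v \<bullet> (M *v v))) *\<^sub>R v \<in> S" if "v \<in> E" "v \<noteq> 0" for v
  proof -
    have "0 < v \<bullet> (M *v v)" using M that by (simp add: pos_def_def)
    then show ?thesis
      using that Esub by (simp add: S_def subspace_scale matrix_vector_mult_scaleR)
  qed
  define f where "f v = (A *v v) \<bullet> (M *v (A *v v))" for v
  have "continuous_on S f" unfolding f_def by (intro continuous_intros)
  then obtain w where w: "w \<in> S" "\<And>v. v \<in> S \<Longrightarrow> f v \<le> f w"
    using continuous_attains_sup[OF \<open>compact S\<close>] nS[OF uE u] by (metis empty_iff)
  define \<mu> where "\<mu> = f w"
  have wE: "w \<in> E" and w1: "w \<bullet> (M *v w) = 1" using w by (auto simp: S_def)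
  have "0 \<le> \<mu>" unfolding \<mu>_def f_def using M by (cases "A *v w = 0") (auto simp: pos_def_def less_imp_le)
  have f_le: "f v \<le> \<mu> * (v \<bullet> (M *v v))" if "v \<in> E" for v
  proof (cases "v = 0")
    case True then show ?thesis by (simp add: f_def)
  next
    case False
    have "0 < v \<bullet> (M *v v)" using M False by (simp add: pos_def_def)
    moreover have "f ((1 / sqrt (v \<bullet> (M *v v))) *\<^sub>R v) \<le> \<mu>"
      unfolding \<mu>_def by (intro w(2) nS that False)
    ultimately show ?thesis
      by (simp add: f_def matrix_vector_mult_scaleR field_simps)
  qed
  \<comment> \<open>The residual of the eigenvalue equation \<open>A\<^sup>2 w = - \<mu> w\<close>.
    It serves as its own test direction.\<close>
  define z where "z = A *v (A *v w) + \<mu> *\<^sub>R w"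
  have zE: "z \<in> E" unfolding z_def using wE Esub by (intro subspace_add subspace_scale EA) auto
  \<comment> \<open>\<open>\<mu> * (v \<bullet> (M *v v)) - f v\<close> is nonnegative on
    \<open>E\<close> and zero at \<open>w\<close>, so its first variation at \<open>w\<close> along
    \<open>z\<close> vanishes.\<close>
  have "2 * (\<mu> * (z \<bullet> (M *v w)) - (A *v z) \<bullet> (M *v (A *v w))) = 0"
  proof (rule linear_quadratic_nonneg_imp_zero)
    fix t
    have symM: "transpose M = M" using M by (simp add: pos_def_def)
    have "w + t *\<^sub>R z \<in> E" using wE zE Esub by (intro subspace_add subspace_scale) auto
    then have "f (w + t *\<^sub>R z) \<le> \<mu> * ((w + t *\<^sub>R z) \<bullet> (M *v (w + t *\<^sub>R z)))" by (rule f_le)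
    moreover have "A *v (w + t *\<^sub>R z) = A *v w + t *\<^sub>R (A *v z)"
      by (simp add: matrix_vector_right_distrib matrix_vector_mult_scaleR)
    ultimately have "f w + 2 * t * ((A *v z) \<bullet> (M *v (A *v w))) + t\<^sup>2 * f z \<le>
        \<mu> * (1 + 2 * t * (z \<bullet> (M *v w)) + t\<^sup>2 * (z \<bullet> (M *v z)))"
      unfolding f_def by (simp only: symmetric_form_add[OF symM] w1)
    then show "0 \<le> t * (2 * (\<mu> * (z \<bullet> (M *v w)) - (A *v z) \<bullet> (M *v (A *v w)))) +
        t\<^sup>2 * (\<mu> * (z \<bullet> (M *v z)) - f z)"
      by (simp add: \<mu>_def algebra_simps)
  qed
  \<comment> \<open>Skewness moves one \<open>A\<close> across the inner product, and the variation
    becomes twice the \<open>M\<close>-square of \<open>z\<close>.\<close>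
  then have "z \<bullet> (M *v z) = 0"
    using skew[OF EA[OF wE], of z] by (simp add: z_def algebra_simps inner_add_right)
  then have "z = 0" using M by (auto simp: pos_def_def)
  then have "A *v (A *v w) = - ((sqrt \<mu>)\<^sup>2) *\<^sub>R w"
    using \<open>0 \<le> \<mu>\<close> by (simp add: z_def eq_neg_iff_add_eq_0)
  moreover have "w \<noteq> 0" using w1 by auto
  ultimately show False
    using square_eigenvector_imp_imaginary_eigenvalue stable by fastforce
qed

lemma bilinear_combination:
  fixes f g :: "'a::real_vector \<Rightarrow> 'b::real_vector \<Rightarrow> real"
  assumes "bilinear f" "bilinear g"
  shows "bilinear (\<lambda>a b. r * f a b + s * g a b)"
  using assms by (simp add: bilinear_def linear_iff algebra_simps)

text \<open>Along \<open>v' = A v\<close> the cross term of \<open>A\<^sup>m v\<close> and \<open>A\<^sup>m\<^sup>+\<^sup>1 v\<close> gains \<open>q (m + 1)\<close>, at the price of a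
  multiple of \<open>q m\<close>, which the form of the previous order absorbs, and a small multiple of
  the squared norm.\<close>

lemma lyapunov_form_up_to_observable_order:
  fixes A Q :: "real^'n^'n"
  defines "q \<equiv> \<lambda>j v. ((*v) A ^^ j) v \<bullet> (Q *v ((*v) A ^^ j) v)"
  assumes Q: "pos_semidef Q" and \<delta>: "0 < \<delta>"
  shows "\<exists>B C. bilinear B \<and> 0 \<le> C \<and>
    (\<forall>v. B v (A *v v) + B (A *v v) v \<le> - (\<Sum>j\<le>m. q j v) + \<delta> * (norm v)\<^sup>2 + C * q 0 v)"
  using \<delta>
proof (induction m arbitrary: \<delta>)
  case (0 \<delta>)
  show ?case
    using 0 by (intro exI[of _ "\<lambda>a b. 0"] exI[of _ 1]) (auto simp: bilinear_def linear_zero)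
next
  case (Suc m \<delta>)
  define P where "P k = ((*v) A ^^ k)" for k
  have bP: "bounded_linear (P k)" for k
    unfolding P_def using linear_matrix_funpow by (simp add: linear_conv_bounded_linear)
  have PA: "P k (A *v v) = P (Suc k) v" for k v
    unfolding P_def by (simp add: funpow_swap1)
  have bPQ: "bounded_bilinear (\<lambda>a b. P j a \<bullet> (Q *v P k b))" for j k
    by (intro bounded_bilinear.comp[OF bounded_bilinear_inner] bP
        bounded_linear_compose[OF matrix_vector_mul_bounded_linear])
  have q0: "0 \<le> q j v" for j v
    using Q by (simp add: q_def pos_semidef_def)
  obtain K where K: "0 < K" "\<And>v. q (Suc (Suc m)) v \<le> K * (norm v)\<^sup>2"
  proof -
    obtain K where "0 < K"
      "\<And>a b. norm (P (Suc (Suc m)) a \<bullet> (Q *v P (Suc (Suc m)) b)) \<le> norm a * norm b * K"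
      using bounded_bilinear.pos_bounded[OF bPQ] by blast
    then show thesis
      by (intro that[of K]) (auto simp: q_def P_def power2_eq_square mult_ac dest: spec order_trans[OF abs_ge_self])
  qed
  \<comment> \<open>Young's inequality with this weight leaves at most
    \<open>\<delta> / 2 * (norm v)\<^sup>2\<close> of the term of order
    \<open>m + 2\<close>.\<close>
  define \<tau> where "\<tau> = K / \<delta>"
  have \<tau>: "0 < \<tau>" using K Suc.prems by (simp add: \<tau>_def)
  \<comment> \<open>The tolerance becomes \<open>\<delta> / 2\<close> after scaling by
    \<open>\<tau> / 2 + 1\<close>.\<close>
  obtain B C where B: "bilinear B" "0 \<le> C" "\<And>v. B v (A *v v) + B (A *v v) v \<le>
      - (\<Sum>j\<le>m. q j v) + \<delta> / (2 * (\<tau> / 2 + 1)) * (norm v)\<^sup>2 + C * q 0 v"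
    using Suc.IH[of "\<delta> / (2 * (\<tau> / 2 + 1))"] Suc.prems \<tau> by auto
  \<comment> \<open>The part \<open>\<tau> / 2\<close> of the factor pays for \<open>q m\<close> in
    Young's inequality; the part 1 keeps the sum of the orders up to \<open>m\<close>.\<close>
  define B' where "B' a b = (\<tau> / 2 + 1) * B a b - P m a \<bullet> (Q *v P (Suc m) b)" for a b
  have "bilinear B'"
  proof -
    have "bilinear (\<lambda>a b. P m a \<bullet> (Q *v P (Suc m) b))"
      using bPQ by (simp add: bilinear_conv_bounded_bilinear)
    then show ?thesis
      using bilinear_combination[OF B(1), of _ "\<tau> / 2 + 1" "- 1"] by (simp add: B'_def[abs_def])
  qed
  moreover have "B' v (A *v v) + B' (A *v v) v \<le>
      - (\<Sum>j\<le>Suc m. q j v) + \<delta> * (norm v)\<^sup>2 + (\<tau> / 2 + 1) * C * q 0 v" for v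
  proof -
    have "- (\<tau> / 2) * q m v - 1 / (2 * \<tau>) * q (Suc (Suc m)) v \<le> P m v \<bullet> (Q *v P (Suc (Suc m)) v)"
      unfolding q_def P_def using pos_semidef_form_ge[OF Q \<tau>] by blast
    moreover have "1 / (2 * \<tau>) * q (Suc (Suc m)) v \<le> 1 / (2 * \<tau>) * (K * (norm v)\<^sup>2)"
      using \<tau> K by (intro mult_left_mono) auto
    moreover have "1 / (2 * \<tau>) * (K * (norm v)\<^sup>2) = \<delta> / 2 * (norm v)\<^sup>2"
      using K Suc.prems by (simp add: \<tau>_def)
    moreover have "B' v (A *v v) + B' (A *v v) v = (\<tau> / 2 + 1) * (B v (A *v v) + B (A *v v) v)
        - P m v \<bullet> (Q *v P (Suc (Suc m)) v) - q (Suc m) v"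
      by (simp add: B'_def PA q_def algebra_simps flip: P_def)
    moreover have "(\<tau> / 2 + 1) * (B v (A *v v) + B (A *v v) v) \<le> (\<tau> / 2 + 1) *
        (- (\<Sum>j\<le>m. q j v) + \<delta> / (2 * (\<tau> / 2 + 1)) * (norm v)\<^sup>2 + C * q 0 v)"
      using \<tau> B(3) by (intro mult_left_mono) auto
    moreover have "(\<tau> / 2 + 1) *
        (- (\<Sum>j\<le>m. q j v) + \<delta> / (2 * (\<tau> / 2 + 1)) * (norm v)\<^sup>2 + C * q 0 v) =
        - (\<tau> / 2 * (\<Sum>j\<le>m. q j v)) - (\<Sum>j\<le>m. q j v) + \<delta> / 2 * (norm v)\<^sup>2 + (\<tau> / 2 + 1) * C * q 0 v"
      using \<tau> by (simp add: divide_simps) (simp add: algebra_simps)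
    moreover have "\<tau> / 2 * q m v \<le> \<tau> / 2 * (\<Sum>j\<le>m. q j v)"
      using \<tau> q0 by (intro mult_left_mono member_le_sum) auto
    ultimately show ?thesis by simp
  qed
  moreover have "0 \<le> (\<tau> / 2 + 1) * C" using \<tau> B(2) by simp
  ultimately show ?case by blast
qed

text \<open>The form of \<open>M\<close> loses exactly \<open>q 0\<close> along the linear flow, so
  a large multiple of it absorbs the excess \<open>C * q 0\<close> of the cross terms and also makes
  the total positive definite.\<close>

lemma strictly_stable_lyapunov_form:
  fixes A M :: "real^'n^'n"
  assumes M: "pos_def M" and Q: "pos_semidef (- (transpose A ** M + M ** A))"
    and stable: "\<And>c. c \<in> eigenvalues A \<Longrightarrow> Re c < 0"
  obtains B c where "bounded_bilinear B" "0 < c" "\<And>v. (norm v)\<^sup>2 \<le> B v v"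
    "\<And>v. B v (A *v v) + B (A *v v) v \<le> - c * (norm v)\<^sup>2"
proof -
  define Q' where "Q' = - (transpose A ** M + M ** A)"
  have Q': "pos_semidef Q'" using Q by (simp add: Q'_def)
  define q where "q j v = ((*v) A ^^ j) v \<bullet> (Q' *v ((*v) A ^^ j) v)" for j v
  have q0: "0 \<le> q j v" for j v
    using Q' by (simp add: q_def pos_semidef_def)
  have cq: "continuous_on UNIV (q j)" for j
    unfolding q_def[abs_def] by (intro continuous_intros)
  have hq: "q j (r *\<^sub>R v) = r\<^sup>2 * q j v" for j r v
    by (simp add: q_def linear_cmul[OF linear_matrix_funpow] matrix_vector_mult_scaleR power2_eq_square)
  have obs: "\<exists>j. 0 < q j v" if "v \<noteq> 0" for v
  proof (rule ccontr)
    assume "\<not> ?thesis"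
    then have "q j v = 0" for j using q0[of j v] by (meson order_antisym_conv not_le)
    then have "Q' *v (((*v) A ^^ j) v) = 0" for j
      unfolding q_def by (rule pos_semidef_null_vector[OF Q'])
    then show False
      using strictly_stable_imp_observable[OF M Q'_def stable] that by blast
  qed
  \<comment> \<open>Observability gives each direction some order \<open>j\<close>; compactness of
    the sphere makes finitely many orders suffice.\<close>
  have "sphere 0 1 \<subseteq> (\<Union>j. {v. 0 < q j v})"
  proof
    fix v :: "real^'n" assume "v \<in> sphere 0 1"
    then have "v \<noteq> 0" by auto
    then show "v \<in> (\<Union>j. {v. 0 < q j v})" using obs by auto
  qed
  moreover have "open {v. 0 < q j v}" for j
    by (intro open_Collect_less cq continuous_intros)
  ultimately obtain J where J: "finite J" "sphere 0 1 \<subseteq> (\<Union>j\<in>J. {v. 0 < q j v})"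
    using compactE_image[OF compact_sphere, of UNIV "\<lambda>j. {v. 0 < q j v}" 0 1] by auto
  obtain m where m: "J \<subseteq> {..m}" using J(1) finite_nat_iff_bounded_le by blast
  have sum_pos: "0 < (\<Sum>j\<le>m. q j v)" if v: "v \<noteq> 0" for v
  proof -
    have "v /\<^sub>R norm v \<in> sphere 0 1" using v by simp
    then obtain j where j: "j \<in> J" "0 < q j (v /\<^sub>R norm v)" using J(2) by blast
    then have "0 < q j v" by (simp add: hq zero_less_mult_iff)
    then show ?thesis
      using j(1) m q0 by (intro sum_pos2[of _ j]) auto
  qed
  obtain c where c: "0 < c" "\<And>v. c * (norm v)\<^sup>2 \<le> (\<Sum>j\<le>m. q j v)"
  proof -
    have cont: "continuous_on UNIV (\<lambda>v. \<Sum>j\<le>m. q j v)"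
      by (intro continuous_on_sum cq)
    have hom: "(\<Sum>j\<le>m. q j (r *\<^sub>R v)) = r\<^sup>2 * (\<Sum>j\<le>m. q j v)" for r v
      by (simp add: hq sum_distrib_left)
    show thesis
      using homogeneous_quadratic_ge[of "\<lambda>v. \<Sum>j\<le>m. q j v", OF cont hom sum_pos] that by metis
  qed
  obtain S C where S: "bilinear S" "0 \<le> C" "\<And>v. S v (A *v v) + S (A *v v) v \<le>
      - (\<Sum>j\<le>m. q j v) + c / 2 * (norm v)\<^sup>2 + C * q 0 v"
    using lyapunov_form_up_to_observable_order[OF Q', of "c / 2" A m] c(1) unfolding q_def by auto
  have bS: "bounded_bilinear S" using S(1) by (simp add: bilinear_conv_bounded_bilinear)
  obtain K where K: "0 < K" "\<And>a b. norm (S a b) \<le> norm a * norm b * K"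
    using bounded_bilinear.pos_bounded[OF bS] by blast
  obtain \<mu> where \<mu>: "0 < \<mu>" "\<And>v. \<mu> * (norm v)\<^sup>2 \<le> v \<bullet> (M *v v)"
    using pos_def_form_ge[OF M] by blast
  \<comment> \<open>\<open>C\<close> absorbs the excess \<open>C * q 0\<close>, and
    \<open>(K + 1) / \<mu>\<close> outweighs \<open>S\<close> with a full
    \<open>(norm v)\<^sup>2\<close> to spare.\<close>
  define r where "r = C + (K + 1) / \<mu>"
  define B where "B a b = r * (a \<bullet> (M *v b)) + S a b" for a b
  have "C \<le> r" using K(1) \<mu>(1) by (simp add: r_def)
  show thesis
  proof
    have "bounded_bilinear (\<lambda>a b. a \<bullet> (M *v b))"
      by (intro bounded_bilinear.comp[OF bounded_bilinear_inner] bounded_linear_ident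
          matrix_vector_mul_bounded_linear)
    then have "bilinear (\<lambda>a b. a \<bullet> (M *v b))"
      by (simp add: bilinear_conv_bounded_bilinear)
    then have "bilinear B"
      using bilinear_combination[OF _ S(1), of _ r 1] by (simp add: B_def[abs_def])
    then show "bounded_bilinear B" by (simp add: bilinear_conv_bounded_bilinear)
    show "0 < c / 2" using c by simp
    fix v
    have "(K + 1) / \<mu> * (\<mu> * (norm v)\<^sup>2) \<le> (K + 1) / \<mu> * (v \<bullet> (M *v v))"
      using \<mu> K(1) by (intro mult_left_mono) auto
    moreover have "0 \<le> v \<bullet> (M *v v)"
      using \<mu>(2)[of v] \<mu>(1) by (meson mult_nonneg_nonneg less_imp_le order_trans zero_le_power2)
    then have "0 \<le> C * (v \<bullet> (M *v v))" using S(2) by simp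
    moreover have "- S v v \<le> (norm v)\<^sup>2 * K"
      using K(2)[of v v] by (simp add: power2_eq_square)
    moreover have "(K + 1) / \<mu> * (\<mu> * (norm v)\<^sup>2) = (norm v)\<^sup>2 * K + (norm v)\<^sup>2"
      using \<mu>(1) by (simp add: field_simps)
    ultimately show "(norm v)\<^sup>2 \<le> B v v"
      unfolding B_def r_def by (simp add: distrib_right)
    have q: "v \<bullet> (M *v (A *v v)) + (A *v v) \<bullet> (M *v v) = - q 0 v"
      using lyapunov_bilinear_form[of v A M v]
      unfolding q_def Q'_def matrix_vector_mult_minus_left by simp
    have "B v (A *v v) + B (A *v v) v =
        r * (v \<bullet> (M *v (A *v v)) + (A *v v) \<bullet> (M *v v)) + (S v (A *v v) + S (A *v v) v)"
      unfolding B_def by (simp add: algebra_simps)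
    also have "\<dots> = - r * q 0 v + (S v (A *v v) + S (A *v v) v)"
      unfolding q by simp
    also have "\<dots> \<le> - r * q 0 v - c / 2 * (norm v)\<^sup>2 + C * q 0 v"
      using S(3)[of v] c(2)[of v] by simp
    also have "\<dots> \<le> - (c / 2) * (norm v)\<^sup>2"
      using mult_right_mono[OF \<open>C \<le> r\<close> q0[of 0 v]] by simp
    finally show "B v (A *v v) + B (A *v v) v \<le> - (c / 2) * (norm v)\<^sup>2" .
  qed
qed

section \<open>Contraction of trajectories\<close>

lemma trajectory_continuous: "trajectory h x0 x \<Longrightarrow> continuous_on {0..} x"
  unfolding trajectory_def by (intro continuous_on_vector_derivative) auto

lemma at_within_atLeast_0: "0 < t \<Longrightarrow> at t within {0..} = at (t::real)"
  by (rule at_within_interior) simp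

lemma trajectory_derivative:
  "trajectory h x0 x \<Longrightarrow> 0 < t \<Longrightarrow> (x has_vector_derivative h (x t)) (at t)"
  unfolding trajectory_def by (metis at_within_atLeast_0 less_imp_le)

text \<open>On \<open>{0..T}\<close> both trajectories stay in one ball, where \<open>h\<close> is
  Lipschitz.\<close>

lemma trajectory_unique:
  assumes h: "C1 h" and x: "trajectory h x0 x" and y: "trajectory h x0 y" and T: "0 \<le> T"
  shows "x T = y T"
proof -
  have cont: "continuous_on {0..T} x" "continuous_on {0..T} y"
    using trajectory_continuous[OF x] trajectory_continuous[OF y] by (auto intro: continuous_on_subset)
  then have "bounded (x ` {0..T} \<union> y ` {0..T})"
    by (auto intro!: compact_imp_bounded compact_continuous_image)
  then obtain R where R: "\<And>z. z \<in> x ` {0..T} \<union> y ` {0..T} \<Longrightarrow> norm z \<le> R"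
    unfolding bounded_iff by metis
  obtain L where "L-lipschitz_on (cball 0 R) h"
    using C1_lipschitz_on_compact[OF h compact_cball convex_cball] by blast
  then show ?thesis
  proof (rule lipschitz_ode_unique[OF _ T _ cont])
    show "x 0 = y 0" using x y by (simp add: trajectory_def)
    show "x t \<in> cball 0 R \<and> y t \<in> cball 0 R" if "0 < t" "t < T" for t
      using R[of "x t"] R[of "y t"] that by auto
  qed (use trajectory_derivative[OF x] trajectory_derivative[OF y] in auto)
qed

lemma trajectory_shift:
  assumes "trajectory h x0 x" "0 \<le> s"
  shows "trajectory h (x s) (\<lambda>t. x (s + t))"
  unfolding trajectory_def
proof (intro conjI allI impI)
  fix t :: real assume t: "0 \<le> t"
  have "(x has_vector_derivative h (x (s + t))) (at (s + t) within {0..})"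
    using assms t by (simp add: trajectory_def)
  then have "(x has_vector_derivative h (x (s + t))) (at (s + t) within (+) s ` {0..})"
    by (rule has_vector_derivative_within_subset) (use assms in auto)
  moreover have "((+) s has_vector_derivative 1) (at t within {0..})"
    by (auto intro!: derivative_eq_intros)
  ultimately have "((x \<circ> (+) s) has_vector_derivative 1 *\<^sub>R h (x (s + t))) (at t within {0..})"
    by (intro vector_diff_chain_within)
  then show "((\<lambda>t. x (s + t)) has_vector_derivative h (x (s + t))) (at t within {0..})"
    by (simp add: comp_def)
qed simp

lemma convergent_trajectory_bounded:
  assumes x: "trajectory h x0 x" and lim: "(x \<longlongrightarrow> p) at_top"
  obtains B where "\<And>t. 0 \<le> t \<Longrightarrow> norm (x t) \<le> B"
proof -
  have "\<forall>\<^sub>F t in at_top. dist (x t) p < 1" using lim by (rule tendstoD) simp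
  then obtain T where T: "\<And>t. T \<le> t \<Longrightarrow> dist (x t) p < 1"
    unfolding eventually_at_top_linorder by blast
  have "bounded (x ` {0..T})"
    using continuous_on_subset[OF trajectory_continuous[OF x], of "{0..T}"]
    by (auto intro!: compact_imp_bounded compact_continuous_image)
  then obtain C where C: "\<And>t. t \<in> {0..T} \<Longrightarrow> norm (x t) \<le> C"
    unfolding bounded_iff by blast
  have "norm (x t) \<le> max C (norm p + 1)" if "0 \<le> t" for t
  proof (cases "t \<le> T")
    case True then show ?thesis using C[of t] that by simp
  next
    case False
    then show ?thesis using T[of t] norm_triangle_sub[of "x t" p] by (simp add: dist_norm)
  qed
  then show thesis by (rule that)
qed

text \<open>Serves to absorb the growth factor at a fixed time. The rate \<open>e\<close> keeps
  \<open>exp (e / 2 * T)\<close> below or at \<open>b\<close>; the added 1s in the denominators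
  cover \<open>a = 0\<close> and \<open>T = 0\<close>.\<close>

lemma exists_small_exp_rate:
  fixes a T \<theta> :: real
  assumes "0 \<le> a" "0 \<le> T" "0 < \<theta>"
  obtains e where "0 < e" "a * exp (e / 2 * T) < a + \<theta>"
proof
  define b where "b = 1 + \<theta> / (a + 1)"
  have b: "1 < b" using assms by (simp add: b_def)
  define e where "e = 2 * ln b / (T + 1)"
  show "0 < e" using b assms by (simp add: e_def)
  have "e / 2 * T = ln b * (T / (T + 1))" using assms(2) by (simp add: e_def divide_simps)
  also have "\<dots> \<le> ln b * 1" using b assms by (intro mult_left_mono) auto
  finally have "exp (e / 2 * T) \<le> exp (ln b)" unfolding exp_le_cancel_iff by simp
  then have "exp (e / 2 * T) \<le> b" using b by simp
  then have "a * exp (e / 2 * T) \<le> a * b" using assms by (intro mult_left_mono) auto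
  also have "\<dots> < a + \<theta>" using assms by (simp add: b_def field_simps)
  finally show "a * exp (e / 2 * T) < a + \<theta>" .
qed

text \<open>\<open>h\<close> is precomposed with the nearest-point projection onto the ball, which
  is 1-Lipschitz and fixes the ball.\<close>

lemma lipschitz_extension_outside_cball:
  fixes h :: "real^'n \<Rightarrow> real^'n"
  assumes h: "C1 h" and R: "0 \<le> R"
  obtains g L where "L-lipschitz_on UNIV g" "\<And>z. norm z \<le> R \<Longrightarrow> g z = h z"
proof -
  have ne: "cball (0::real^'n) R \<noteq> {}" using R by simp
  obtain L where L: "L-lipschitz_on (cball 0 R) h"
    using C1_lipschitz_on_compact[OF h compact_cball convex_cball] by blast
  have "1-lipschitz_on UNIV (closest_point (cball (0::real^'n) R))"
    using closest_point_lipschitz[OF convex_cball closed_cball ne] by (simp add: lipschitz_on_def)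
  moreover have "L-lipschitz_on (closest_point (cball 0 R) ` UNIV) h"
    using closest_point_in_set[OF closed_cball ne] by (intro lipschitz_on_subset[OF L]) blast
  ultimately have "(L * 1)-lipschitz_on UNIV (\<lambda>z. h (closest_point (cball 0 R) z))"
    by (rule lipschitz_on_compose2)
  moreover have "closest_point (cball 0 R) z = z" if "norm z \<le> R" for z
    using that by (intro closest_point_self) simp
  ultimately show thesis using that by metis
qed

text \<open>Linearity identifies the coordinate sum with the directional derivative, the form in
  which the chain rule produces it.\<close>

lemma metric_dot_eq_derivative:
  assumes "C1 M"
  shows "metric_dot M h x t = frechet_derivative M (at x) (h x t)"
proof -
  have lin: "linear (frechet_derivative M (at x))"
    using C1_bounded_linear[OF assms] by (rule bounded_linear.linear)
  have "frechet_derivative M (at x) (h x t) =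
      frechet_derivative M (at x) (\<Sum>i\<in>UNIV. (h x t $ i) *\<^sub>R axis i 1)"
    using basis_expansion[of "h x t"] by (simp add: scalar_mult_eq_scaleR)
  then show ?thesis
    by (simp add: metric_dot_def linear_sum[OF lin] linear_cmul[OF lin])
qed

lemma jacobian_eq_derivative:
  assumes "C1 h"
  shows "jacobian h (at x) *v v = frechet_derivative h (at x) v"
proof -
  have "(h has_derivative (\<lambda>v. jacobian h (at x) *v v)) (at x)"
    using assms by (simp add: C1_def flip: jacobian_works)
  from frechet_derivative_at[OF this] show ?thesis by metis
qed

section \<open>Contraction estimates in the metric\<close>

locale semi_contracting_system =
  fixes h :: "real^'n \<Rightarrow> real^'n" and M :: "real^'n \<Rightarrow> real^'n^'n" and \<beta>0 \<beta>1 :: real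
  assumes h: "C1 h" and M: "is_metric M" and semi: "semi_contracting (\<lambda>x t. h x) M"
    and \<beta>0: "0 < \<beta>0" and \<beta>1: "0 < \<beta>1"
    and lower: "\<beta>0\<^sup>2 * (norm v)\<^sup>2 \<le> v \<bullet> (M x *v v)"
    and upper: "v \<bullet> (M x *v v) \<le> \<beta>1\<^sup>2 * (norm v)\<^sup>2"
begin

abbreviation "\<kappa> \<equiv> \<beta>1 / \<beta>0"

lemma M_C1: "C1 M" and M_sym: "transpose (M x) = M x" and M_pos_def: "pos_def (M x)"
  using M by (auto simp: is_metric_def pos_def_def)

lemma M_pos_semidef: "pos_semidef (M x)"
  using M_pos_def[of x] unfolding pos_def_def pos_semidef_def
  by (metis inner_zero_left less_eq_real_def)

lemma semi_contraction_form:
  "v \<bullet> (frechet_derivative M (at x) (h x) *v v) + 2 * (v \<bullet> (M x *v frechet_derivative h (at x) v)) \<le> 0"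
proof -
  let ?A = "jacobian h (at x)"
  have "metric_dot M (\<lambda>x t. h x) x 0 + transpose ?A ** M x + M x ** ?A \<preceq> 0"
    using semi unfolding semi_contracting_def Let_def by blast
  then have "0 \<le> v \<bullet> ((- (metric_dot M (\<lambda>x t. h x) x 0 + (transpose ?A ** M x + M x ** ?A))) *v v)"
    unfolding loewner_le_def pos_semidef_def by (simp add: add.assoc)
  then have "v \<bullet> (frechet_derivative M (at x) (h x) *v v) +
      v \<bullet> ((transpose ?A ** M x + M x ** ?A) *v v) \<le> 0"
    unfolding matrix_vector_mult_minus_left
    by (simp add: metric_dot_eq_derivative[OF M_C1] matrix_vector_mult_add_rdistrib[of "frechet_derivative M (at x) (h x)"]
        inner_add_right inner_diff_right)
  then show ?thesis
    using symmetric_form_commute[OF M_sym, of "?A *v v" x v]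
    unfolding lyapunov_bilinear_form jacobian_eq_derivative[OF h] by simp
qed

text \<open>The tangent estimate is applied to the finite difference \<open>y - x\<close>. The
  linearization error of \<open>h\<close> is uniformly small on \<open>K\<close>, and Young's
  inequality turns it into the rate \<open>e\<close>.\<close>

lemma nearby_contraction_rate:
  assumes K: "compact K" "convex K" and e: "0 < e"
  shows "\<exists>d>0. \<forall>x\<in>K. \<forall>y\<in>K. norm (y - x) < d \<longrightarrow>
    (y - x) \<bullet> (frechet_derivative M (at x) (h x) *v (y - x)) + 2 * ((y - x) \<bullet> (M x *v (h y - h x)))
      \<le> e * ((y - x) \<bullet> (M x *v (y - x)))"
proof -
  define \<tau> where "\<tau> = e / 2"
  have \<tau>: "0 < \<tau>" using e by (simp add: \<tau>_def)
  \<comment> \<open>With this tolerance the bounds on the metric give an error \<open>r\<close> of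
    \<open>M x\<close>-length at most \<tau> times that of \<open>u\<close>.\<close>
  have "0 < \<tau> / \<kappa>" using \<tau> \<beta>0 \<beta>1 by simp
  from C1_uniform_linearization[OF h K this] obtain d where d: "0 < d" and
    lin: "\<And>x y. x \<in> K \<Longrightarrow> y \<in> K \<Longrightarrow> norm (y - x) < d \<Longrightarrow>
      norm (h y - h x - frechet_derivative h (at x) (y - x)) \<le> \<tau> / \<kappa> * norm (y - x)"
    by blast
  show ?thesis
  proof (intro exI[of _ d] conjI ballI impI d)
    fix x y assume xy: "x \<in> K" "y \<in> K" "norm (y - x) < d"
    define u where "u = y - x"
    define r where "r = h y - h x - frechet_derivative h (at x) u"
    have "norm r \<le> \<tau> / \<kappa> * norm u" unfolding r_def u_def by (rule lin[OF xy])
    then have "(norm r)\<^sup>2 \<le> (\<tau> / \<kappa> * norm u)\<^sup>2" by (intro power_mono) auto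
    then have "\<beta>1\<^sup>2 * (norm r)\<^sup>2 \<le> \<beta>1\<^sup>2 * (\<tau> / \<kappa> * norm u)\<^sup>2" by (intro mult_left_mono) auto
    also have "\<dots> = \<tau>\<^sup>2 * (\<beta>0\<^sup>2 * (norm u)\<^sup>2)"
      using \<beta>0 \<beta>1 by (simp add: power_mult_distrib power_divide)
    also have "\<dots> \<le> \<tau>\<^sup>2 * (u \<bullet> (M x *v u))"
      by (intro mult_left_mono lower) auto
    finally have "r \<bullet> (M x *v r) \<le> \<tau>\<^sup>2 * (u \<bullet> (M x *v u))" using upper order_trans by blast
    then have "1 / (2 * \<tau>) * (r \<bullet> (M x *v r)) \<le> 1 / (2 * \<tau>) * (\<tau>\<^sup>2 * (u \<bullet> (M x *v u)))"
      using \<tau> by (intro mult_left_mono) auto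
    also have "\<dots> = \<tau> / 2 * (u \<bullet> (M x *v u))" using \<tau> by (simp add: power2_eq_square)
    finally have "1 / (2 * \<tau>) * (r \<bullet> (M x *v r)) \<le> \<tau> / 2 * (u \<bullet> (M x *v u))" .
    moreover have "- (\<tau> / 2) * (u \<bullet> (M x *v u)) - 1 / (2 * \<tau>) * (r \<bullet> (M x *v r)) \<le> - (u \<bullet> (M x *v r))"
      using pos_semidef_form_ge[OF M_pos_semidef \<tau>, of u x "- r"]
      by (simp add: matrix_vector_mult_scaleR[of _ "- 1", simplified])
    moreover have "u \<bullet> (M x *v (h y - h x)) =
        u \<bullet> (M x *v frechet_derivative h (at x) u) + u \<bullet> (M x *v r)"
      by (simp add: r_def matrix_vector_mult_diff_distrib inner_diff_right)
    ultimately have "u \<bullet> (frechet_derivative M (at x) (h x) *v u) + 2 * (u \<bullet> (M x *v (h y - h x)))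
        \<le> 2 * \<tau> * (u \<bullet> (M x *v u))"
      using semi_contraction_form[of u x] by simp
    then show "(y - x) \<bullet> (frechet_derivative M (at x) (h x) *v (y - x)) + 2 * ((y - x) \<bullet> (M x *v (h y - h x)))
      \<le> e * ((y - x) \<bullet> (M x *v (y - x)))"
      by (simp add: u_def \<tau>_def)
  qed
qed

text \<open>The difference is measured in the metric at \<open>x t\<close>. Gronwall's inequality
  bounds its growth, and comparing with the Euclidean norm at both ends costs the factor
  \<open>\<kappa>\<close>.\<close>

lemma nearby_solutions_contract:
  assumes rate: "\<forall>x\<in>K. \<forall>y\<in>K. norm (y - x) < d \<longrightarrow>
    (y - x) \<bullet> (frechet_derivative M (at x) (h x) *v (y - x)) + 2 * ((y - x) \<bullet> (M x *v (h y - h x)))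
      \<le> e * ((y - x) \<bullet> (M x *v (y - x)))"
    and T: "0 \<le> T" and cont: "continuous_on {0..T} x" "continuous_on {0..T} y"
    and sol: "\<And>t. 0 < t \<Longrightarrow> t < T \<Longrightarrow> (x has_vector_derivative h (x t)) (at t)"
      "\<And>t. 0 < t \<Longrightarrow> t < T \<Longrightarrow> (y has_vector_derivative h (y t)) (at t)"
    and K: "\<And>t. 0 < t \<Longrightarrow> t < T \<Longrightarrow> x t \<in> K \<and> y t \<in> K \<and> norm (y t - x t) < d"
  shows "norm (y T - x T) \<le> \<kappa> * exp (e / 2 * T) * norm (y 0 - x 0)"
proof -
  define u where "u t = y t - x t" for t
  define V where "V t = u t \<bullet> (M (x t) *v u t)" for t
  have "V T \<le> exp (e * T) * V 0"
  proof (rule differential_inequality_exp_bound[OF T])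
    have cu: "continuous_on {0..T} u" unfolding u_def by (intro continuous_intros cont)
    have cM: "continuous_on UNIV M"
      by (intro continuous_at_imp_continuous_on ballI has_derivative_continuous[OF C1_has_derivative[OF M_C1]])
    show "continuous_on {0..T} V"
      unfolding V_def
      by (intro continuous_on_inner cu
          bounded_bilinear.continuous_on[OF bounded_bilinear_matrix_vector_mult]
          continuous_on_compose2[OF cM cont(1) subset_UNIV])
    fix t assume t: "0 < t" "t < T"
    have u': "(u has_vector_derivative h (y t) - h (x t)) (at t)"
      unfolding u_def by (intro derivative_intros sol t)
    have "((\<lambda>t. M (x t)) has_vector_derivative frechet_derivative M (at (x t)) (h (x t))) (at t)"
      using vector_derivative_diff_chain_within[OF sol(1)[OF t], of M]
        has_derivative_at_withinI[OF C1_has_derivative[OF M_C1]] by (simp add: comp_def)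
    from bounded_bilinear.has_vector_derivative[OF bounded_bilinear_inner u'
        bounded_bilinear.has_vector_derivative[OF bounded_bilinear_matrix_vector_mult this u']]
    show "(V has_real_derivative u t \<bullet> (frechet_derivative M (at (x t)) (h (x t)) *v u t) +
        2 * (u t \<bullet> (M (x t) *v (h (y t) - h (x t))))) (at t)"
      using symmetric_form_commute[OF M_sym, of "h (y t) - h (x t)" "x t" "u t"]
      by (simp add: V_def[abs_def] has_real_derivative_iff_has_vector_derivative inner_add_right add_ac)
    show "u t \<bullet> (frechet_derivative M (at (x t)) (h (x t)) *v u t) +
        2 * (u t \<bullet> (M (x t) *v (h (y t) - h (x t)))) \<le> e * V t"
      unfolding V_def u_def using rate K[OF t] by blast
  qed
  also have "\<dots> \<le> exp (e * T) * (\<beta>1\<^sup>2 * (norm (u 0))\<^sup>2)"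
    unfolding V_def by (intro mult_left_mono upper) auto
  finally have "\<beta>0\<^sup>2 * (norm (u T))\<^sup>2 \<le> exp (e * T) * (\<beta>1\<^sup>2 * (norm (u 0))\<^sup>2)"
    using lower[of "u T" "x T"] unfolding V_def by (rule order_trans[rotated])
  also have "exp (e * T) = (exp (e / 2 * T))\<^sup>2"
    by (simp flip: exp_double)
  finally have "(\<beta>0 * norm (u T))\<^sup>2 \<le> (\<beta>1 * exp (e / 2 * T) * norm (u 0))\<^sup>2"
    by (simp add: power_mult_distrib mult_ac)
  then have "\<beta>0 * norm (u T) \<le> \<beta>1 * exp (e / 2 * T) * norm (u 0)"
    by (rule power2_le_imp_le) (use \<beta>1 in auto)
  then show ?thesis using \<beta>0 by (simp add: u_def field_simps)
qed

text \<open>Subdividing the segment between the initial values makes neighbouring trajectories so close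
  that \<open>nearby_contraction_rate\<close> applies; summing over the chain recovers the bound
  for the end points. The vector field is first made globally Lipschitz, so that all solutions exist.\<close>

lemma trajectory_contraction:
  assumes x: "trajectory h x0 x" and bounded: "\<And>t. 0 \<le> t \<Longrightarrow> norm (x t) \<le> B"
  shows "\<exists>y. trajectory h y0 y \<and> (\<forall>t\<ge>0. norm (y t - x t) \<le> \<kappa> * norm (y0 - x0))"
proof -
  define D where "D = \<kappa> * norm (y0 - x0)"
  have D: "0 \<le> D" using \<beta>0 \<beta>1 by (simp add: D_def)
  \<comment> \<open>The slack 1 leaves room for the temporary loss \<theta>, which is at most
    1.\<close>
  define R where "R = B + D + 1"
  have B: "0 \<le> B" using bounded[of 0] norm_ge_zero order_trans by blast
  then have R: "0 \<le> R" using D by (simp add: R_def)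
  obtain g L where lip: "L-lipschitz_on UNIV g" and gh: "\<And>z. norm z \<le> R \<Longrightarrow> g z = h z"
    using lipschitz_extension_outside_cball[OF h R] by blast
  \<comment> \<open>A solution of the extended field is fixed for each initial value, with the given
    \<open>x\<close> kept as the one from \<open>x0\<close>.\<close>
  have "\<exists>z. trajectory g w z \<and> (w = x0 \<longrightarrow> z = x)" for w
  proof (cases "w = x0")
    case True
    have "g (x t) = h (x t)" if "0 \<le> t" for t using bounded[OF that] D by (intro gh) (simp add: R_def)
    then have "trajectory g x0 x" using x by (simp add: trajectory_def)
    then show ?thesis using True by blast
  next
    case False
    then show ?thesis using lipschitz_ode_solution_exists[OF lip, of w] by (simp add: trajectory_def)
  qed
  then obtain Z where Z: "\<And>w. trajectory g w (Z w)" and Zx: "Z x0 = x" by metis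
  \<comment> \<open>The partition depends on \<open>T\<close> and \<theta>; only the resulting bound
    survives the limit in which \<theta> tends to 0.\<close>
  have bound: "norm (Z y0 T - x T) \<le> D + \<theta>" if T: "0 \<le> T" and \<theta>: "0 < \<theta>" "\<theta> \<le> 1" for T \<theta>
  proof -
    obtain e where e: "0 < e" "D * exp (e / 2 * T) < D + \<theta>"
      using exists_small_exp_rate[OF D T \<theta>(1)] by blast
    obtain d where d: "0 < d" and rate: "\<forall>x\<in>cball 0 R. \<forall>y\<in>cball 0 R. norm (y - x) < d \<longrightarrow>
        (y - x) \<bullet> (frechet_derivative M (at x) (h x) *v (y - x)) + 2 * ((y - x) \<bullet> (M x *v (h y - h x)))
        \<le> e * ((y - x) \<bullet> (M x *v (y - x)))"
      using nearby_contraction_rate[OF compact_cball convex_cball e(1)] by blast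
    obtain N :: nat where N: "(D + \<theta>) / d < real N" using reals_Archimedean2 by blast
    moreover have "0 < (D + \<theta>) / d" using D \<theta> d by simp
    ultimately have N0: "0 < real N" by linarith
    \<comment> \<open>The gap allowed between neighbours: \<open>N\<close> of them add up to
      \<open>D + \<theta>\<close>, and \<open>N\<close> was chosen so that each is below
      \<open>d\<close>.\<close>
    define c where "c = (D + \<theta>) / N"
    have c: "c < d" using N N0 d by (simp add: c_def field_simps)
    define w where "w i = x0 + (real i / N) *\<^sub>R (y0 - x0)" for i
    define z where "z i = Z (w i)" for i
    have z0: "z 0 = x" by (simp add: z_def w_def Zx)
    have zN: "z N = Z y0" using N0 by (simp add: z_def w_def)
    have zt: "trajectory g (w i) (z i)" for i unfolding z_def by (rule Z)
    have zc: "continuous_on {0..S} (z i)" for i S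
      by (rule continuous_on_subset[OF trajectory_continuous[OF zt]]) auto
    have chain: "norm (z j t - x t) \<le> j * c"
      if "\<And>i. i < N \<Longrightarrow> norm (z (Suc i) t - z i t) < c" "j \<le> N" for j t
      using that(2)
    proof (induction j)
      case 0 then show ?case by (simp add: z0)
    next
      case (Suc j)
      have "norm (z (Suc j) t - x t) \<le> norm (z (Suc j) t - z j t) + norm (z j t - x t)"
        using norm_triangle_ineq[of "z (Suc j) t - z j t" "z j t - x t"] by simp
      then show ?case using Suc that(1)[of j] by (simp add: algebra_simps)
    qed
    have jc: "real j * c \<le> D + \<theta>" if "j \<le> N" for j
    proof -
      have "real j * c \<le> real N * c" using that D \<theta> N0 by (intro mult_right_mono) (auto simp: c_def)
      also have "\<dots> = D + \<theta>" using N0 by (simp add: c_def)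
      finally show ?thesis .
    qed
    have gap: "norm (z (Suc i) T - z i T) < c" if "i < N" for i
    proof (rule ccontr)
      assume bad: "\<not> norm (z (Suc i) T - z i T) < c"
      \<comment> \<open>The bad times of all pairs are collected, so that before the first one every
        gap is below \<open>c\<close>. Until then the whole chain stays in the ball where
        \<open>g\<close> and \<open>h\<close> agree, and the contraction estimate contradicts the
        gap at that time.\<close>
      define Bad where "Bad = (\<Union>i<N. {t \<in> {0..T}. c \<le> norm (z (Suc i) t - z i t)})"
      have "T \<in> Bad" unfolding Bad_def using that T bad by (auto intro!: bexI[of _ i])
      have "closed Bad"
        unfolding Bad_def
        by (intro closed_UN ballI continuous_on_closed_Collect_le continuous_intros zc) auto
      moreover have "Bad \<subseteq> {0..T}" by (auto simp: Bad_def)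
      ultimately have "compact Bad"
        by (meson bounded_closed_interval bounded_subset compact_eq_bounded_closed)
      then obtain s where s: "s \<in> Bad" "\<And>t. t \<in> Bad \<Longrightarrow> s \<le> t"
        using compact_attains_inf[OF \<open>compact Bad\<close>] \<open>T \<in> Bad\<close> by (metis empty_iff)
      then obtain j where j: "j < N" "c \<le> norm (z (Suc j) s - z j s)" and sT: "0 \<le> s" "s \<le> T"
        by (auto simp: Bad_def)
      have before: "norm (z (Suc i) t - z i t) < c" if "i < N" "0 < t" "t < s" for i t
        using s(2)[of t] that sT by (force simp: Bad_def)
      have inK: "norm (z i t) \<le> R" if "i \<le> N" "0 < t" "t < s" for i t
      proof -
        have "norm (z i t - x t) \<le> D + \<theta>"
          using chain[of t i] before that jc[of i] by force
        then show ?thesis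
          using bounded[of t] that \<theta>(2) norm_triangle_sub[of "z i t" "x t"] by (simp add: R_def)
      qed
      have sol: "(z i has_vector_derivative h (z i t)) (at t)" if "i \<le> N" "0 < t" "t < s" for i t
        using trajectory_derivative[OF zt that(2), of i] gh[OF inK[OF that]] by simp
      \<comment> \<open>This includes \<open>s = 0\<close>, where the conditions on the open
        interval are vacuous.\<close>
      have "norm (z (Suc j) s - z j s) \<le> \<kappa> * exp (e / 2 * s) * norm (z (Suc j) 0 - z j 0)"
      proof (rule nearby_solutions_contract[OF rate sT(1) zc zc])
        show "z j t \<in> cball 0 R \<and> z (Suc j) t \<in> cball 0 R \<and> norm (z (Suc j) t - z j t) < d"
          if "0 < t" "t < s" for t
          using inK[of j t] inK[of "Suc j" t] before[of j t] that j(1) c by simp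
      qed (use sol j(1) in auto)
      also have "norm (z (Suc j) 0 - z j 0) = norm (y0 - x0) / N"
      proof -
        have "z (Suc j) 0 - z j 0 = (1 / real N) *\<^sub>R (y0 - x0)"
          using zt[of j] zt[of "Suc j"] by (simp add: trajectory_def w_def add_divide_distrib scaleR_left_distrib)
        then show ?thesis using N0 by simp
      qed
      also have "\<kappa> * exp (e / 2 * s) * (norm (y0 - x0) / N) = D * exp (e / 2 * s) / N"
        by (simp add: D_def)
      also have "\<dots> \<le> D * exp (e / 2 * T) / N"
        using D N0 e(1) sT by (intro divide_right_mono mult_left_mono) auto
      also have "\<dots> < c"
        using e(2) N0 by (simp add: c_def divide_strict_right_mono)
      finally show False using j(2) by simp
    qed
    show ?thesis using chain[OF gap, of N] jc[of N] by (simp add: zN)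
  qed
  have close: "norm (Z y0 t - x t) \<le> D" if "0 \<le> t" for t
  proof (rule field_le_epsilon)
    fix \<theta> :: real assume "0 < \<theta>"
    then show "norm (Z y0 t - x t) \<le> D + \<theta>" using bound[OF that, of "min \<theta> 1"] by simp
  qed
  \<comment> \<open>The bound confines \<open>Z y0\<close> to the ball, so the solution of the
    extended equation solves the original one for all times.\<close>
  have "g (Z y0 t) = h (Z y0 t)" if "0 \<le> t" for t
    using close[OF that] bounded[OF that] norm_triangle_sub[of "Z y0 t" "x t"]
    by (intro gh) (simp add: R_def)
  then have "trajectory h y0 (Z y0)" using Z[of y0] by (simp add: trajectory_def)
  then show ?thesis using close unfolding D_def by blast
qed

section \<open>The basin of attraction\<close>

lemma attracted_toI:
  assumes "trajectory h x0 x" "(x \<longlongrightarrow> p) at_top"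
  shows "attracted_to h x0 p"
  unfolding attracted_to_def
proof (intro conjI allI impI)
  fix y assume "trajectory h x0 y"
  then have "\<forall>\<^sub>F t in at_top. x t = y t"
    using trajectory_unique[OF h assms(1)] by (intro eventually_at_top_linorderI[of 0]) auto
  then show "(y \<longlongrightarrow> p) at_top" using assms(2) by (rule Lim_transform_eventually[rotated])
qed (use assms in blast)

text \<open>\<open>x\<close> comes within \<open>\<delta> / 2\<close> of \<open>p\<close> and
  \<open>y\<close> stays within \<open>\<delta> / 2\<close> of \<open>x\<close>, so \<open>y\<close>
  enters the local basin. The radius does not depend on \<open>x0\<close>.\<close>

lemma basin_uniform_neighbourhood:
  assumes local: "\<And>w. dist w p < \<delta> \<Longrightarrow> attracted_to h w p" and \<delta>: "0 < \<delta>"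
    and x0: "attracted_to h x0 p" and y0: "dist y0 x0 < \<delta> / (2 * \<kappa>)"
  shows "attracted_to h y0 p"
proof -
  obtain x where x: "trajectory h x0 x" "(x \<longlongrightarrow> p) at_top"
    using x0 unfolding attracted_to_def by blast
  obtain B where "\<And>t. 0 \<le> t \<Longrightarrow> norm (x t) \<le> B"
    using convergent_trajectory_bounded[OF x] by blast
  then obtain y where y: "trajectory h y0 y" "\<And>t. 0 \<le> t \<Longrightarrow> norm (y t - x t) \<le> \<kappa> * norm (y0 - x0)"
    using trajectory_contraction[OF x(1), of B y0] by blast
  have "\<forall>\<^sub>F t in at_top. dist (x t) p < \<delta> / 2" using x(2) by (rule tendstoD) (use \<delta> in simp)
  then obtain s where s: "\<And>t. s \<le> t \<Longrightarrow> dist (x t) p < \<delta> / 2"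
    unfolding eventually_at_top_linorder by blast
  \<comment> \<open>The time \<open>s\<close> from the limit may be negative, while trajectories
    start at 0.\<close>
  define r where "r = max s 0"
  have "\<kappa> * norm (y0 - x0) < \<delta> / 2"
    using y0 \<beta>0 \<beta>1 by (simp add: dist_norm field_simps)
  moreover have "norm (y r - x r) \<le> \<kappa> * norm (y0 - x0)" by (rule y(2)) (simp add: r_def)
  moreover have "dist (x r) p < \<delta> / 2" by (rule s) (simp add: r_def)
  ultimately have "dist (y r) p < \<delta>"
    using dist_triangle[of "y r" p "x r"] unfolding dist_norm[of "y r" "x r"] by linarith
  then have "attracted_to h (y r) p" by (rule local)
  then have "((\<lambda>t. y (r + t)) \<longlongrightarrow> p) at_top"
    using trajectory_shift[OF y(1), of r] by (simp add: attracted_to_def r_def)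
  then have "(y \<longlongrightarrow> p) at_top"
    using filterlim_compose[of "\<lambda>t. y (r + t)" "nhds p" at_top "\<lambda>t. - r + t" at_top]
      filterlim_tendsto_add_at_top[OF tendsto_const filterlim_ident, of "- r"] by simp
  then show ?thesis using y(1) by (intro attracted_toI)
qed

text \<open>The uniform radius makes both the basin and its complement open; connectedness does the
  rest.\<close>

lemma local_attraction_imp_global:
  assumes local: "\<And>w. dist w p < \<delta> \<Longrightarrow> attracted_to h w p" and \<delta>: "0 < \<delta>"
  shows "attracted_to h x0 p"
proof -
  define S where "S = {x0. attracted_to h x0 p}"
  define r where "r = \<delta> / (2 * \<kappa>)"
  have r: "0 < r" using \<delta> \<beta>0 \<beta>1 by (simp add: r_def)
  have step: "y \<in> S" if "x \<in> S" "dist y x < r" for x y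
    using basin_uniform_neighbourhood[OF local \<delta>] that unfolding S_def r_def by blast
  have "open S" unfolding open_dist using step r by blast
  moreover have "open (- S)" unfolding open_dist using step r by (metis Compl_iff dist_commute)
  moreover have "p \<in> S" using local[of p] \<delta> by (simp add: S_def)
  ultimately have "S = UNIV" using clopen[of S] by (auto simp: closed_def)
  then show ?thesis by (auto simp: S_def)
qed

text \<open>At the equilibrium the derivative of the metric drops out because
  \<open>h p = 0\<close>, which gives the semidefiniteness needed for the Lyapunov form. That form
  then decays exponentially along the nonlinear trajectories near \<open>p\<close>.\<close>

lemma strictly_stable_imp_local_attraction:
  assumes p: "equilibrium h p" and stable: "strictly_stable_linearization h p"
  obtains \<delta> where "0 < \<delta>" "\<And>w. dist w p < \<delta> \<Longrightarrow> attracted_to h w p"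
proof -
  define A where "A = jacobian h (at p)"
  have hp: "h p = 0" using p by (simp add: equilibrium_def)
  have "metric_dot M (\<lambda>x t. h x) p 0 + transpose A ** M p + M p ** A \<preceq> 0"
    using semi unfolding semi_contracting_def Let_def A_def by blast
  then have Q: "pos_semidef (- (transpose A ** M p + M p ** A))"
    by (simp add: loewner_le_def metric_dot_def hp)
  obtain P c where P: "bounded_bilinear P" and c: "0 < c" and lowerP: "\<And>v. (norm v)\<^sup>2 \<le> P v v"
    and decay: "\<And>v. P v (A *v v) + P (A *v v) v \<le> - c * (norm v)\<^sup>2"
    using strictly_stable_lyapunov_form[OF M_pos_def Q] stable
    unfolding strictly_stable_linearization_def A_def by blast
  obtain K where K: "0 < K" "\<And>a b. norm (P a b) \<le> norm a * norm b * K"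
    using bounded_bilinear.pos_bounded[OF P] by blast
  \<comment> \<open>The remainder contributes at most \<open>2 * e * K = c / 2\<close>, half of the
    decay.\<close>
  define e where "e = c / (4 * K)"
  have e: "0 < e" using c K by (simp add: e_def)
  obtain d where d: "0 < d" "\<And>y. norm (y - p) < d \<Longrightarrow> norm (h y - A *v (y - p)) \<le> e * norm (y - p)"
  proof -
    have "(h has_derivative (\<lambda>v. A *v v)) (at p)"
      using h by (simp add: A_def C1_def flip: jacobian_works)
    then show thesis using e that unfolding has_derivative_at_alt hp by auto
  qed
  show thesis
  proof
    show "0 < d / \<kappa>" using d \<beta>0 \<beta>1 by simp
    fix w assume "dist w p < d / \<kappa>"
    then have w: "\<kappa> * norm (w - p) < d"
      using \<beta>0 \<beta>1 by (simp add: dist_norm field_simps)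
    \<comment> \<open>Comparison with the constant trajectory gives existence for all times and
      keeps \<open>x\<close> in the ball of the linearization, without an invariance argument for
      the Lyapunov function.\<close>
    have "trajectory h p (\<lambda>t. p)" by (simp add: trajectory_def hp)
    from trajectory_contraction[OF this order_refl, of w] obtain x where
      x: "trajectory h w x" "\<And>t. 0 \<le> t \<Longrightarrow> norm (x t - p) \<le> \<kappa> * norm (w - p)" by blast
    define u where "u t = x t - p" for t
    define V where "V t = P (u t) (u t)" for t
    \<comment> \<open>Since \<open>V t \<le> K * (norm (u t))\<^sup>2\<close>, the remaining decay
      \<open>c / 2\<close> yields the rate \<open>a\<close> for \<open>V\<close>.\<close>
    define a where "a = c / (2 * K)"
    have a: "0 < a" using c K by (simp add: a_def)
    have "V T \<le> exp (- a * T) * V 0" if T: "0 \<le> T" for T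
    proof (rule differential_inequality_exp_bound[OF T])
      have "continuous_on {0..T} u"
        unfolding u_def by (intro continuous_intros continuous_on_subset[OF trajectory_continuous[OF x(1)]]) auto
      then show "continuous_on {0..T} V"
        unfolding V_def by (intro bounded_bilinear.continuous_on[OF P])
      fix t assume t: "0 < t" "t < T"
      have "(u has_vector_derivative h (x t)) (at t)"
        unfolding u_def[abs_def] using trajectory_derivative[OF x(1) t(1)] by (auto intro!: derivative_eq_intros)
      from bounded_bilinear.has_vector_derivative[OF P this this]
      show "(V has_real_derivative P (u t) (h (x t)) + P (h (x t)) (u t)) (at t)"
        by (simp add: V_def[abs_def] has_real_derivative_iff_has_vector_derivative)
      define r where "r = h (x t) - A *v u t"
      have "norm (u t) < d" using x(2)[of t] w t by (simp add: u_def)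
      then have r: "norm r \<le> e * norm (u t)" using d(2)[of "x t"] by (simp add: r_def u_def)
      have hx: "h (x t) = A *v u t + r" by (simp add: r_def)
      have "P (u t) (h (x t)) + P (h (x t)) (u t) =
          (P (u t) (A *v u t) + P (A *v u t) (u t)) + (P (u t) r + P r (u t))"
        unfolding hx bounded_bilinear.add_left[OF P] bounded_bilinear.add_right[OF P] by simp
      also have "\<dots> \<le> - c * (norm (u t))\<^sup>2 + 2 * (norm (u t) * norm r * K)"
        using decay[of "u t"] K(2)[of "u t" r] K(2)[of r "u t"] by (simp add: mult_ac)
      also have "\<dots> \<le> - c * (norm (u t))\<^sup>2 + 2 * (norm (u t) * (e * norm (u t)) * K)"
        using r K(1) by (intro add_left_mono mult_left_mono mult_right_mono) auto
      also have "\<dots> = - (c / 2) * (norm (u t))\<^sup>2"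
        using K(1) by (simp add: e_def power2_eq_square field_simps)
      also have "\<dots> = - a * (norm (u t) * norm (u t) * K)"
        using K(1) by (simp add: a_def power2_eq_square)
      also have "\<dots> \<le> - a * V t"
        using K(2)[of "u t" "u t"] a by (simp add: V_def)
      finally show "P (u t) (h (x t)) + P (h (x t)) (u t) \<le> - a * V t" .
    qed
    then have "norm (u t) \<le> sqrt (exp (- a * t) * V 0)" if "0 \<le> t" for t
      using lowerP[of "u t"] that order_trans by (intro real_le_rsqrt) (fastforce simp: V_def)
    then have ev: "\<forall>\<^sub>F t in at_top. norm (u t) \<le> sqrt (exp (- a * t) * V 0)"
      by (intro eventually_at_top_linorderI[of 0])
    have "filterlim (\<lambda>t. - a * t) at_bot at_top"
      using a by (intro filterlim_tendsto_neg_mult_at_bot[OF tendsto_const _ filterlim_ident]) auto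
    then have "((\<lambda>t. exp (- a * t)) \<longlongrightarrow> 0) at_top"
      by (rule filterlim_compose[OF exp_at_bot])
    then have "((\<lambda>t. sqrt (exp (- a * t) * V 0)) \<longlongrightarrow> sqrt (0 * V 0)) at_top"
      by (intro tendsto_real_sqrt tendsto_mult tendsto_const)
    then have "(u \<longlongrightarrow> 0) at_top"
      using Lim_null_comparison[OF ev] by simp
    then have "(x \<longlongrightarrow> p) at_top" unfolding u_def by (simp add: LIM_zero_iff)
    then show "attracted_to h w p" using x(1) by (intro attracted_toI)
  qed
qed

end

theorem proposition7:
  fixes h :: "real^'n \<Rightarrow> real^'n"
    and M :: "real^'n \<Rightarrow> real^'n^'n"
    and \<beta>0 \<beta>1 :: real
  assumes "C1 h"
    and "is_metric M"
    and "semi_contracting (\<lambda>x t. h x) M"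
    and "0 \<prec> \<beta>0\<^sup>2 *\<^sub>R mat 1"
    and "\<And>x. \<beta>0\<^sup>2 *\<^sub>R mat 1 \<preceq> M x"
    and "\<And>x. M x \<preceq> \<beta>1\<^sup>2 *\<^sub>R mat 1"
  shows "(\<forall>p. equilibrium h p \<and> locally_asymptotically_stable h p \<longrightarrow>
              globally_asymptotically_stable h p) \<and>
         (\<forall>p. equilibrium h p \<and> strictly_stable_linearization h p \<longrightarrow>
              (\<forall>x0. attracted_to h x0 p))"
proof -
  have form: "v \<bullet> ((b *\<^sub>R mat 1) *v v) = b * (norm v)\<^sup>2" for b and v :: "real^'n"
    by (simp add: power2_norm_eq_inner flip: scaleR_matrix_vector_assoc)
  have lower: "\<beta>0\<^sup>2 * (norm v)\<^sup>2 \<le> v \<bullet> (M x *v v)" for v x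
    using assms(5)[of x]
    by (simp add: loewner_le_def pos_semidef_def matrix_vector_mult_diff_rdistrib inner_diff_right form)
  have upper: "v \<bullet> (M x *v v) \<le> \<beta>1\<^sup>2 * (norm v)\<^sup>2" for v x
    using assms(6)[of x]
    by (simp add: loewner_le_def pos_semidef_def matrix_vector_mult_diff_rdistrib inner_diff_right form)
  \<comment> \<open>The space has positive dimension, so a unit vector can extract scalar facts
    about the constants from the matrix inequalities.\<close>
  obtain v :: "real^'n" where v: "norm v = 1" using vector_choose_size[of 1] by auto
  then have "v \<noteq> 0" by auto
  then have "0 < \<beta>0\<^sup>2"
    using assms(4) v form[of v "\<beta>0\<^sup>2"] by (auto simp: loewner_less_def pos_def_def dest!: spec[of _ v])
  moreover have "\<beta>0\<^sup>2 \<le> \<beta>1\<^sup>2" using order_trans[OF lower upper, of v] v by simp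
  ultimately have "0 < \<beta>1\<^sup>2" by linarith
  \<comment> \<open>Only the squares of the constants enter the hypotheses, so absolute values
    supply the positive signs that the locale asks for.\<close>
  with \<open>0 < \<beta>0\<^sup>2\<close> interpret semi_contracting_system h M "\<bar>\<beta>0\<bar>" "\<bar>\<beta>1\<bar>"
    using assms(1-3) lower upper by unfold_locales simp_all
  \<comment> \<open>Lyapunov stability is the same clause in the local and the global notion, so
    only attraction has to be globalized.\<close>
  show ?thesis
    using local_attraction_imp_global strictly_stable_imp_local_attraction
    unfolding globally_asymptotically_stable_def locally_asymptotically_stable_def by metis
qed

end
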